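(* Let $\mathbb{F}$ be a field (of arbitrary characteristic), let $b$ be a symplectic form on a finite-dimensional vector space $V$ over $\mathbb{F}$, and let $u$ be a $b$-alternating endomorphism of $V$. The following conditions are equivalent: (i) $u$ is the sum of two square-zero $b$-alternating endomorphisms of $V$; (ii) $u$ is the sum of two square-zero endomorphisms of $V$; (iii) every invariant factor of $u$ is even or odd. Moreover, if the characteristic of $\mathbb{F}$ is not $2$, these conditions are equivalent to each one of the following: (iv) $u$ is similar to $-u$; (v) $u$ is conjugated to $-u$ through an element of the symplectic group of $b$.
   Context: A symplectic form is a non-degenerate alternating bilinear form. An endomorphism $u$ of $V$ is $b$-alternating if $b(x,u(x))=0$ for all $x\in V$ (if the characteristic is not $2$ and $b$ is alternating, this is equivalent to $u$ being $b$-selfadjoint). A polynomial in $\mathbb{F}[t]$ is even if it belongs to $\mathbb{F}[t^2]$, and odd if it belongs to $t\,\mathbb{F}[t^2]$. The invariant factors of $u$ are the nonconstant monic polynomials $p_1,\dots,p_r$, with $p_{i+1}$ dividing $p_i$, such that $V$ with the $\mathbb{F}[t]$-module structure $p\cdot x=p(u)[x]$ is isomorphic to $\bigoplus_i \mathbb{F}[t]/(p_i)$. The symplectic group of $b$ is the group of linear automorphisms $g$ of $V$ with $b(g(x),g(y))=b(x,y)$ for all $x,y$. *)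

theory Defs
  imports "HOL-Computational_Algebra.Computational_Algebra" "HOL-Library.FuncSet"
begin

text \<open>The vector space is a whole type \<open>'v\<close>, with scalar multiplication \<open>scale\<close> over the field \<open>'a\<close>.\<close>

definition bilinear_form ::
  "('a::field \<Rightarrow> 'v::ab_group_add \<Rightarrow> 'v) \<Rightarrow> ('v \<Rightarrow> 'v \<Rightarrow> 'a) \<Rightarrow> bool" where
  "bilinear_form scale b \<longleftrightarrow>
     (\<forall>x. Vector_Spaces.linear scale (*) (\<lambda>y. b x y)) \<and>
     (\<forall>y. Vector_Spaces.linear scale (*) (\<lambda>x. b x y))"

definition nondegenerate_form :: "('v::zero \<Rightarrow> 'v \<Rightarrow> 'a::zero) \<Rightarrow> bool" where
  "nondegenerate_form b \<longleftrightarrow>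
     (\<forall>x. (\<forall>y. b x y = 0) \<longrightarrow> x = 0) \<and> (\<forall>y. (\<forall>x. b x y = 0) \<longrightarrow> y = 0)"

definition symplectic_form ::
  "('a::field \<Rightarrow> 'v::ab_group_add \<Rightarrow> 'v) \<Rightarrow> ('v \<Rightarrow> 'v \<Rightarrow> 'a) \<Rightarrow> bool" where
  "symplectic_form scale b \<longleftrightarrow>
     bilinear_form scale b \<and> (\<forall>x. b x x = 0) \<and> nondegenerate_form b"

definition endomorphism ::
  "('a::field \<Rightarrow> 'v::ab_group_add \<Rightarrow> 'v) \<Rightarrow> ('v \<Rightarrow> 'v) \<Rightarrow> bool" where
  "endomorphism scale u \<longleftrightarrow> Vector_Spaces.linear scale scale u"

definition automorphism ::
  "('a::field \<Rightarrow> 'v::ab_group_add \<Rightarrow> 'v) \<Rightarrow> ('v \<Rightarrow> 'v) \<Rightarrow> bool" where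
  "automorphism scale g \<longleftrightarrow> endomorphism scale g \<and> bij g"

definition alternating_endomorphism ::
  "('a::field \<Rightarrow> 'v::ab_group_add \<Rightarrow> 'v) \<Rightarrow> ('v \<Rightarrow> 'v \<Rightarrow> 'a) \<Rightarrow> ('v \<Rightarrow> 'v) \<Rightarrow> bool" where
  "alternating_endomorphism scale b u \<longleftrightarrow> endomorphism scale u \<and> (\<forall>x. b x (u x) = 0)"

definition square_zero :: "('v::zero \<Rightarrow> 'v) \<Rightarrow> bool" where
  "square_zero u \<longleftrightarrow> (\<forall>x. u (u x) = 0)"

definition conjugated_by :: "('v \<Rightarrow> 'v) \<Rightarrow> ('v \<Rightarrow> 'v) \<Rightarrow> ('v \<Rightarrow> 'v) \<Rightarrow> bool" where
  "conjugated_by g u v \<longleftrightarrow> v = g \<circ> u \<circ> inv g"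

definition similar_endomorphisms ::
  "('a::field \<Rightarrow> 'v::ab_group_add \<Rightarrow> 'v) \<Rightarrow> ('v \<Rightarrow> 'v) \<Rightarrow> ('v \<Rightarrow> 'v) \<Rightarrow> bool" where
  "similar_endomorphisms scale u v \<longleftrightarrow> (\<exists>g. automorphism scale g \<and> conjugated_by g u v)"

definition symplectic_group ::
  "('a::field \<Rightarrow> 'v::ab_group_add \<Rightarrow> 'v) \<Rightarrow> ('v \<Rightarrow> 'v \<Rightarrow> 'a) \<Rightarrow> ('v \<Rightarrow> 'v) set" where
  "symplectic_group scale b = {g. automorphism scale g \<and> (\<forall>x y. b (g x) (g y) = b x y)}"

definition even_poly :: "'a::comm_semiring_1 poly \<Rightarrow> bool" where
  "even_poly p \<longleftrightarrow> (\<exists>q. p = pcompose q (monom 1 2))"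

definition odd_poly :: "'a::comm_semiring_1 poly \<Rightarrow> bool" where
  "odd_poly p \<longleftrightarrow> (\<exists>q. p = monom 1 1 * pcompose q (monom 1 2))"

text \<open>The \<open>\<F>[t]\<close>-module structure \<open>p \<cdot> x = p(u)[x]\<close>.\<close>

definition poly_action ::
  "('a::field \<Rightarrow> 'v::ab_group_add \<Rightarrow> 'v) \<Rightarrow> ('v \<Rightarrow> 'v) \<Rightarrow> 'a poly \<Rightarrow> 'v \<Rightarrow> 'v" where
  "poly_action scale u p x = (\<Sum>i\<le>degree p. scale (coeff p i) ((u ^^ i) x))"

text \<open>For \<open>p \<noteq> 0\<close>, the quotient \<open>\<F>[t]/(p)\<close> is modelled on the canonical representatives,
  the remainders modulo \<open>p\<close>, with the module operations taken modulo \<open>p\<close>.\<close>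

definition poly_residues :: "'a::field poly \<Rightarrow> 'a poly set" where
  "poly_residues p = {f. f mod p = f}"

definition isomorphic_to_cyclic_sum ::
  "('a::field \<Rightarrow> 'v::ab_group_add \<Rightarrow> 'v) \<Rightarrow> ('v \<Rightarrow> 'v) \<Rightarrow> 'a poly list \<Rightarrow> bool" where
  "isomorphic_to_cyclic_sum scale u ps \<longleftrightarrow>
     (\<exists>\<phi>. bij_betw \<phi> UNIV (\<Pi>\<^sub>E i\<in>{..<length ps}. poly_residues (ps ! i)) \<and>
          (\<forall>x y. \<forall>i<length ps. \<phi> (x + y) i = (\<phi> x i + \<phi> y i) mod (ps ! i)) \<and>
          (\<forall>q x. \<forall>i<length ps. \<phi> (poly_action scale u q x) i = (q * \<phi> x i) mod (ps ! i)))"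

definition invariant_factor_list ::
  "('a::field \<Rightarrow> 'v::ab_group_add \<Rightarrow> 'v) \<Rightarrow> ('v \<Rightarrow> 'v) \<Rightarrow> 'a poly list \<Rightarrow> bool" where
  "invariant_factor_list scale u ps \<longleftrightarrow>
     (\<forall>p\<in>set ps. degree p > 0 \<and> lead_coeff p = 1) \<and>
     (\<forall>i. Suc i < length ps \<longrightarrow> ps ! Suc i dvd ps ! i) \<and>
     isomorphic_to_cyclic_sum scale u ps"

text \<open>By the structure theorem such a list exists and is unique when \<open>V\<close> is finite-dimensional
  and \<open>u\<close> is linear.\<close>

definition invariant_factor ::
  "('a::field \<Rightarrow> 'v::ab_group_add \<Rightarrow> 'v) \<Rightarrow> ('v \<Rightarrow> 'v) \<Rightarrow> 'a poly \<Rightarrow> bool" where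
  "invariant_factor scale u p \<longleftrightarrow> (\<exists>ps. invariant_factor_list scale u ps \<and> p \<in> set ps)"

end

theory Submission
  imports Defs
begin

text \<open>
  Regard \<open>V\<close> as a module over \<open>\<F>[t]\<close> through \<open>u\<close>. All conditions say that \<open>V\<close> carries a grading by
  \<open>\<int>/2\<close> for which \<open>u\<close> is odd.

  \<^emph>\<open>Parity is necessary.\<close> Suppose that \<open>u = v + w\<close> with \<open>v\<^sup>2 = w\<^sup>2 = 0\<close>. In characteristic 2,
  \<open>u v + v u = u\<^sup>2\<close> says that \<open>v\<close> acts on \<open>V\<close> as a derivation that lies over the derivation
  \<open>p \<mapsto> t\<^sup>2 p'\<close> of \<open>\<F>[t]\<close>; applied to the relation \<open>p \<cdot> z = 0\<close> for the generator \<open>z\<close> of a cyclic summand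
  it yields \<open>p dvd t\<^sup>2 p'\<close>, and this forces \<open>p\<close> to be a power of \<open>t\<close> times an even polynomial
  (\<open>cyclic_basis_derivation\<close>, \<open>parity_poly_of_dvd_pderiv\<close>). In other characteristics \<open>c = v - w\<close>
  satisfies \<open>c u = - u c\<close> and \<open>c\<^sup>2 = - u\<^sup>2\<close>. An invariant factor \<open>p\<^sub>k\<^sub>+\<^sub>1\<close> is characterised by the number of
  generators: \<open>q \<cdot> V\<close> is generated by \<open>k\<close> vectors only if \<open>p\<^sub>k\<^sub>+\<^sub>1 dvd q\<close>. Transporting generators of
  \<open>p\<^sub>k\<^sub>+\<^sub>1 \<cdot> V\<close> by \<open>c\<close> gives \<open>p dvd t\<^sup>2 p(-t)\<close> for \<open>p = p\<^sub>k\<^sub>+\<^sub>1\<close>, with the same conclusion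
  (\<open>cyclic_basis_anticommuting\<close>, \<open>parity_poly_of_dvd_reflect\<close>). The same argument applies to an
  operator \<open>c\<close> that conjugates \<open>u\<close> into \<open>- u\<close>.

  \<^emph>\<open>Parity is sufficient.\<close> As \<open>b\<close> and \<open>u\<close> are alternating, every cyclic submodule is totally isotropic.
  A vector \<open>x\<close> of maximal order \<open>m\<close> has a partner \<open>y\<close> such that \<open>b (f \<cdot> x) (g \<cdot> y)\<close> is the coefficient of
  index \<open>degree m - 1\<close> of \<open>f * g\<close> modulo \<open>m\<close>, and the orthogonal complement of the two cyclic modules is
  again stable and nondegenerate (\<open>split_hyperbolic_pair\<close>). By induction \<open>V\<close> is an orthogonal sum of such
  pairs, and the orders \<open>m\<close>, each taken twice, are the invariant factors (\<open>symplectic_decomposition\<close>).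
  If \<open>m\<close> is even or odd, the even and the odd multiples of \<open>x\<close> are exchanged by \<open>u\<close>, and so are those of
  \<open>y\<close>; since the pairing sees only one parity, the pieces can be assembled into \<open>M \<oplus> N\<close> in two ways:
  with \<open>M\<close> and \<open>N\<close> totally isotropic, or with \<open>M\<close> orthogonal to \<open>N\<close> (\<open>hyperbolic_pair_sums\<close>). In the first
  case, \<open>u\<close> restricted to \<open>M\<close> and extended by zero to \<open>N\<close>, and likewise with \<open>M\<close> and \<open>N\<close> exchanged, are
  square-zero and alternating with sum \<open>u\<close>. In the second case, the involution \<open>1\<close> on \<open>M\<close> and \<open>-1\<close> on
  \<open>N\<close> is symplectic and conjugates \<open>u\<close> into \<open>- u\<close>.
\<close>

section \<open>Even and odd polynomials\<close>

text \<open>Even polynomials are the case \<open>n = 0\<close>, odd ones the case \<open>n = 1\<close>. The index matters only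
  modulo 2; it makes parity additive under products, and it lets a polynomial be compared with the
  parity of its own degree.\<close>
definition parity_poly :: "nat \<Rightarrow> 'a::comm_semiring_1 poly \<Rightarrow> bool" where
  "parity_poly n p \<longleftrightarrow> (\<forall>i. coeff p i \<noteq> 0 \<longrightarrow> even (i + n))"

lemma coeff_pcompose_square:
  fixes q :: "'a::comm_semiring_1 poly"
  shows "coeff (pcompose q (monom 1 2)) n = (if even n then coeff q (n div 2) else 0)"
proof (induction q arbitrary: n)
  case (pCons a q)
  show ?case
  proof (cases "n < 2")
    case True
    then have "n = 0 \<or> n = 1" by auto
    then show ?thesis
      by (auto simp: pcompose_pCons coeff_monom_mult)
  next
    case False
    then obtain k where k: "n = Suc (Suc k)"
      by (metis add_2_eq_Suc le_Suc_ex not_less)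
    show ?thesis
      by (simp add: k pcompose_pCons coeff_monom_mult pCons.IH)
  qed
qed simp

lemma even_poly_iff: "even_poly p \<longleftrightarrow> parity_poly 0 p"
proof
  assume "even_poly p"
  then show "parity_poly 0 p"
    by (auto simp: even_poly_def parity_poly_def coeff_pcompose_square split: if_splits)
next
  assume p: "parity_poly 0 p"
  define q where "q = (\<Sum>i\<le>degree p. monom (coeff p (2 * i)) i)"
  have cq: "coeff q i = coeff p (2 * i)" for i
  proof (cases "i \<le> degree p")
    case False
    then show ?thesis by (simp add: q_def coeff_sum coeff_eq_0)
  qed (simp add: q_def coeff_sum)
  have "p = pcompose q (monom 1 2)"
    using p by (intro poly_eqI) (auto simp: coeff_pcompose_square cq parity_poly_def)
  then show "even_poly p" by (auto simp: even_poly_def)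
qed

lemma odd_poly_iff: "odd_poly p \<longleftrightarrow> parity_poly 1 p"
proof
  assume "odd_poly p"
  then show "parity_poly 1 p"
    by (auto simp: odd_poly_def parity_poly_def coeff_pcompose_square coeff_monom_mult split: if_splits)
next
  assume p: "parity_poly 1 p"
  define q where "q = poly_shift 1 p"
  have 0: "coeff p 0 = 0" using p by (auto simp: parity_poly_def)
  have pq: "p = monom 1 1 * q"
  proof (rule poly_eqI)
    fix n show "coeff p n = coeff (monom 1 1 * q) n"
      by (cases n) (simp_all add: 0 q_def coeff_poly_shift coeff_monom_mult)
  qed
  have "parity_poly 0 q"
    using p unfolding parity_poly_def q_def coeff_poly_shift by fastforce
  then obtain r where "q = pcompose r (monom 1 2)"
    using even_poly_iff[of q] by (auto simp: even_poly_def)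
  then show "odd_poly p" using pq by (auto simp: odd_poly_def)
qed

lemma parity_poly_0 [simp]: "parity_poly n 0"
  by (simp add: parity_poly_def)

lemma parity_poly_cong: "even (m + n) \<Longrightarrow> parity_poly m p \<longleftrightarrow> parity_poly n p"
  by (auto simp: parity_poly_def)

lemma parity_poly_add: "parity_poly n p \<Longrightarrow> parity_poly n q \<Longrightarrow> parity_poly n (p + q)"
  unfolding parity_poly_def by (metis add.left_neutral coeff_add)

lemma parity_poly_mult:
  assumes "parity_poly m p" "parity_poly n q"
  shows "parity_poly (m + n) (p * q)"
  unfolding parity_poly_def
proof (intro allI impI)
  fix k assume "coeff (p * q) k \<noteq> 0"
  then obtain i where i: "i \<le> k" "coeff p i * coeff q (k - i) \<noteq> 0"
    unfolding coeff_mult using sum.not_neutral_contains_not_neutral by blast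
  then have "even (i + m)" "even (k - i + n)"
    using assms unfolding parity_poly_def by (metis mult_zero_left mult_zero_right)+
  then show "even (k + (m + n))" using i(1) by presburger
qed

lemma parity_poly_monom: "even (i + n) \<Longrightarrow> parity_poly n (monom c i)"
  by (auto simp: parity_poly_def coeff_monom split: if_splits)

lemma parity_poly_uminus: "parity_poly n (p :: 'a::comm_ring_1 poly) \<Longrightarrow> parity_poly n (- p)"
  by (simp add: parity_poly_def)

lemma parity_poly_diff:
  "parity_poly n (p :: 'a::comm_ring_1 poly) \<Longrightarrow> parity_poly n q \<Longrightarrow> parity_poly n (p - q)"
  using parity_poly_add[of n p "- q"] by (simp add: parity_poly_uminus)

text \<open>The leading coefficient leaves only one possible parity, namely that of the degree.\<close>
lemma even_or_odd_poly_iff: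
  assumes "p \<noteq> 0"
  shows "even_poly p \<or> odd_poly p \<longleftrightarrow> parity_poly (degree p) p"
proof -
  have lead: "coeff p (degree p) \<noteq> 0" using assms by simp
  have "parity_poly (degree p) p" if "parity_poly n p" for n
    using that lead parity_poly_cong[of n "degree p" p] by (auto simp: parity_poly_def add.commute)
  moreover have "parity_poly 0 p \<or> parity_poly 1 p" if "parity_poly (degree p) p"
    using that by (auto simp: parity_poly_def)
  ultimately show ?thesis by (auto simp: even_poly_iff odd_poly_iff)
qed

lemma parity_parts:
  fixes p :: "'a::comm_ring_1 poly"
  obtains q r where "p = q + r" "parity_poly n q" "parity_poly (Suc n) r"
proof -
  define q where "q = (\<Sum>i\<le>degree p. if even (i + n) then monom (coeff p i) i else 0)"
  have cq: "coeff q k = (if even (k + n) then coeff p k else 0)" for k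
  proof -
    have "coeff q k = (\<Sum>i\<le>degree p. if i = k then (if even (k + n) then coeff p k else 0) else 0)"
      unfolding q_def coeff_sum by (rule sum.cong) auto
    then show ?thesis by (simp add: coeff_eq_0)
  qed
  show thesis
    by (rule that[of q "p - q"]) (auto simp: parity_poly_def cq)
qed

text \<open>Long division by a polynomial of the parity of its degree subtracts, at each step, a multiple
  that has the parity of the dividend.\<close>
lemma parity_poly_mod:
  fixes f m :: "'a::field poly"
  assumes "parity_poly (degree m) m" "parity_poly n f"
  shows "parity_poly n (f mod m)"
  using assms(2)
proof (induction "degree f" arbitrary: f rule: less_induct)
  case less
  consider "m = 0" | "degree f < degree m" | "m \<noteq> 0" "degree m = 0" | "m \<noteq> 0" "degree m > 0" "degree m \<le> degree f"
    by fastforce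
  then show ?case
  proof cases
    case 3
    then show ?thesis
      by (metis degree_0 degree_mod_less less_nat_zero_code parity_poly_0)
  next
    case 4
    then have f: "f \<noteq> 0" by auto
    define c where "c = monom (lead_coeff f / lead_coeff m) (degree f - degree m)"
    have deg: "degree (c * m) = degree f"
      using 4 f by (simp add: c_def degree_mult_eq degree_monom_eq)
    have "lead_coeff (c * m) = lead_coeff f"
      using 4 f by (simp add: c_def lead_coeff_mult degree_monom_eq)
    then have lc: "coeff (f - c * m) (degree f) = 0" by (simp add: deg)
    have "degree (f - c * m) \<le> degree f"
      using deg by (metis degree_diff_le order_refl)
    moreover have "degree (f - c * m) \<noteq> degree f"
    proof
      assume eq: "degree (f - c * m) = degree f"
      then have "f - c * m = 0" using lc by (metis leading_coeff_0_iff)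
      then show False using eq 4 by simp
    qed
    ultimately have "degree (f - c * m) < degree f" by simp
    moreover have "parity_poly n (f - c * m)"
    proof (rule parity_poly_diff[OF less.prems])
      have "even (degree f + n)" using less.prems f by (auto simp: parity_poly_def)
      then have "parity_poly (n + degree m) c"
        unfolding c_def using 4(3) by (intro parity_poly_monom) presburger
      then have "parity_poly (n + degree m + degree m) (c * m)"
        using assms(1) by (rule parity_poly_mult)
      then show "parity_poly n (c * m)"
        using parity_poly_cong[of "n + degree m + degree m" n "c * m"]
        by (metis add.assoc even_add)
    qed
    ultimately have "parity_poly n ((f - c * m) mod m)" by (rule less.hyps)
    moreover have "(f - c * m) mod m = f mod m"
      by (metis mod_mult_self2 diff_add_cancel mult.commute)
    ultimately show ?thesis by simp
  qed (use less.prems mod_poly_less in \<open>auto simp: mod_poly_less\<close>)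
qed

section \<open>Ideals and irreducible divisors of polynomials over a field\<close>

lemma poly_ideal_principal:
  fixes I :: "'a::field poly set"
  assumes add: "\<And>f g. f \<in> I \<Longrightarrow> g \<in> I \<Longrightarrow> f + g \<in> I"
    and mult: "\<And>f g. f \<in> I \<Longrightarrow> g * f \<in> I"
    and nz: "p \<in> I" "p \<noteq> 0"
  obtains g where "g \<in> I" "lead_coeff g = 1" "\<And>f. f \<in> I \<longleftrightarrow> g dvd f"
proof -
  obtain h where h: "h \<in> I" "h \<noteq> 0" and min: "\<And>f. f \<in> I \<Longrightarrow> f \<noteq> 0 \<Longrightarrow> degree h \<le> degree f"
    using ex_has_least_nat[of "\<lambda>f. f \<in> I \<and> f \<noteq> 0" p degree] nz by blast
  define g where "g = smult (inverse (lead_coeff h)) h"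
  have gI: "g \<in> I"
    using mult[OF h(1), of "[:inverse (lead_coeff h):]"] by (simp add: g_def)
  have lc: "lead_coeff g = 1" using h(2) by (simp add: g_def)
  have "degree g = degree h" using h(2) by (simp add: g_def)
  moreover have "f \<in> I \<longleftrightarrow> g dvd f" for f
  proof
    assume f: "f \<in> I"
    have "f mod g = f + (- (f div g)) * g"
      by (simp add: minus_div_mult_eq_mod [symmetric])
    then have "f mod g \<in> I" using f gI add mult by metis
    then have "f mod g = 0"
      using min[of "f mod g"] degree_mod_less[of g f] \<open>degree g = degree h\<close> h(2) lc by fastforce
    then show "g dvd f" by (simp add: dvd_eq_mod_eq_0)
  next
    assume "g dvd f" then show "f \<in> I" using gI mult by (metis dvd_def mult.commute)
  qed
  ultimately show thesis
    using that[OF gI lc] by blast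
qed

lemma monic_degree_0: "lead_coeff g = 1 \<Longrightarrow> degree g = 0 \<Longrightarrow> g = 1"
  by (metis degree_eq_zeroE lead_coeff_pCons(2) one_pCons)

lemma monic_dvd_degree_le:
  fixes f g :: "'a::field poly"
  assumes "g dvd f" "degree f \<le> degree g" "f \<noteq> 0"
  shows "f dvd g"
proof -
  obtain c where c: "f = g * c" using assms(1) by auto
  then have "c \<noteq> 0" "g \<noteq> 0" "degree c = 0"
    using assms by (auto simp: degree_mult_eq)
  then obtain a where "c = [:a:]" "a \<noteq> 0" by (metis degree_eq_zeroE pCons_0_0)
  then have "g = f * [:inverse a:]" using c by simp
  then show ?thesis by (metis dvd_triv_left)
qed

text \<open>A nonconstant divisor of least degree is irreducible, hence coprime, with all its powers, to
  every polynomial that it does not divide.\<close>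
lemma minimal_divisor_coprime:
  fixes r f :: "'a::field poly"
  assumes pi: "\<pi> dvd r" "degree \<pi> > 0"
    and min: "\<And>h. h dvd r \<Longrightarrow> degree h > 0 \<Longrightarrow> degree \<pi> \<le> degree h"
    and ndvd: "\<not> \<pi> dvd f"
  shows "\<exists>s t. s * f + t * \<pi> ^ n = 1"
proof (induction n)
  case 0
  show ?case by (rule exI[of _ 0], rule exI[of _ 1]) simp
next
  case (Suc n)
  define I where "I = {s * f + t * \<pi> | s t. True}"
  have gen: "f \<in> I" "\<pi> \<in> I"
    unfolding I_def by (rule CollectI, rule exI[of _ 1], rule exI[of _ 0], simp)
      (rule CollectI, rule exI[of _ 0], rule exI[of _ 1], simp)
  have "\<pi> \<noteq> 0" using pi by auto
  have add: "x + y \<in> I" if "x \<in> I" "y \<in> I" for x y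
  proof -
    from that obtain s t s' t' where "x = s * f + t * \<pi>" "y = s' * f + t' * \<pi>"
      by (auto simp: I_def)
    then have "x + y = (s + s') * f + (t + t') * \<pi>" by (simp add: algebra_simps)
    then show ?thesis by (auto simp: I_def)
  qed
  have mult: "y * x \<in> I" if "x \<in> I" for x y
  proof -
    from that obtain s t where "x = s * f + t * \<pi>" by (auto simp: I_def)
    then have "y * x = (y * s) * f + (y * t) * \<pi>" by (simp add: algebra_simps)
    then show ?thesis unfolding I_def by blast
  qed
  obtain g where g: "g \<in> I" "lead_coeff g = 1" "\<And>f. f \<in> I \<longleftrightarrow> g dvd f"
    by (rule poly_ideal_principal[of I \<pi>, OF add mult gen(2) \<open>\<pi> \<noteq> 0\<close>]) blast+
  have "degree g = 0"
  proof (rule ccontr)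
    assume "degree g \<noteq> 0"
    then have "degree \<pi> \<le> degree g"
      using min[of g] g(3) gen pi(1) dvd_trans by blast
    then have "\<pi> dvd g" using monic_dvd_degree_le g(3) gen \<open>\<pi> \<noteq> 0\<close> by blast
    then show False using ndvd g(3) gen dvd_trans by blast
  qed
  then have "1 \<in> I" using g monic_degree_0 by metis
  then obtain s t where st: "s * f + t * \<pi> = 1" by (auto simp: I_def)
  obtain s' t' where st': "s' * f + t' * \<pi> ^ n = 1" using Suc by blast
  \<comment> \<open>The product of a Bezout identity for \<open>\<pi> ^ n\<close> and one for \<open>\<pi>\<close> is one for \<open>\<pi> ^ Suc n\<close>.\<close>
  have "1 = (s' * f + t' * \<pi> ^ n) * (s * f + t * \<pi>)" by (simp add: st st')
  also have "\<dots> = (s' * (s * f + t * \<pi>) + t' * \<pi> ^ n * s) * f + (t' * t) * \<pi> ^ Suc n"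
    by (simp add: algebra_simps)
  finally show ?case by metis
qed

lemma factor_out_power:
  fixes p \<pi> :: "'a::field poly"
  assumes "p \<noteq> 0" "degree \<pi> > 0"
  obtains n q where "p = \<pi> ^ n * q" "\<not> \<pi> dvd q"
  using assms(1)
proof (induction "degree p" arbitrary: p thesis rule: less_induct)
  case less
  show ?case
  proof (cases "\<pi> dvd p")
    case False
    then show ?thesis using less.prems(1)[of 0 p] by simp
  next
    case True
    then obtain r where r: "p = \<pi> * r" by auto
    then have "r \<noteq> 0" using less.prems by auto
    moreover have "degree r < degree p"
      using r less.prems assms(2) by (auto simp: degree_mult_eq)
    ultimately obtain n q where "r = \<pi> ^ n * q" "\<not> \<pi> dvd q"
      using less.hyps by metis
    then show ?thesis using less.prems(1)[of "Suc n" q] r by (simp add: mult.assoc)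
  qed
qed

section \<open>Divisibility criteria for parity\<close>

text \<open>In characteristic 2 an odd exponent equals 1 in the field, so a vanishing derivative kills
  every coefficient of odd index.\<close>
lemma pderiv_zero_imp_even:
  fixes r :: "'a::field poly"
  assumes "(2::'a) = 0" "pderiv r = 0"
  shows "parity_poly 0 r"
  unfolding parity_poly_def
proof (intro allI impI)
  fix i assume nz: "coeff r i \<noteq> 0"
  show "even (i + 0)"
  proof (rule ccontr)
    assume "odd (i + 0)"
    then obtain k where k: "i = Suc (2 * k)" by (metis add_0_right oddE Suc_eq_plus1)
    have "of_nat (Suc (2 * k)) * coeff r i = 0"
      using assms(2) k by (metis coeff_pderiv coeff_0)
    moreover have "of_nat (Suc (2 * k)) = (1::'a)" using assms(1) by simp
    ultimately show False using nz by simp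
  qed
qed

lemma split_off_t:
  fixes p :: "'a::field poly"
  assumes "p \<noteq> 0"
  obtains n r where "p = monom 1 n * r" "coeff r 0 \<noteq> 0"
proof -
  obtain n r where r: "p = [:0, 1:] ^ n * r" "\<not> [:0, 1:] dvd r"
    using factor_out_power[OF assms, of "[:0, 1:]"] by auto
  moreover have "coeff r 0 \<noteq> 0"
    using r(2) dvd_iff_poly_eq_0[of 0 r] by (simp add: poly_0_coeff_0)
  ultimately show thesis using that by (simp add: monom_altdef)
qed

lemma dvd_t_power_mult_cancel:
  fixes r s :: "'a::field poly"
  assumes "coeff r 0 \<noteq> 0" "r dvd monom 1 n * s"
  shows "r dvd s"
  using assms(2)
proof (induction n)
  case (Suc n)
  then obtain k where k: "monom 1 (Suc n) * s = r * k" by auto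
  then have "coeff r 0 * coeff k 0 = 0"
    by (metis coeff_mult_0 coeff_monom mult_zero_left nat.distinct(1))
  then have "coeff k 0 = 0" using assms(1) by simp
  then have "k = pCons 0 (poly_shift 1 k)"
    by (intro poly_eqI) (auto simp: coeff_pCons coeff_poly_shift split: nat.splits)
  then have "r * k = pCons 0 (r * poly_shift 1 k)"
    by (metis add_0 mult_pCons_right smult_0_left)
  then have "monom 1 n * s = r * poly_shift 1 k"
    using k by (simp add: monom_Suc)
  then have "r dvd monom 1 n * s" by simp
  then show ?case by (rule Suc.IH)
qed simp

lemma parity_poly_monom_mult:
  fixes r :: "'a::field poly"
  assumes "parity_poly 0 r" "r \<noteq> 0"
  shows "parity_poly (degree (monom 1 n * r)) (monom 1 n * r)"
proof -
  have "parity_poly (n + 0) (monom 1 n * r)"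
    by (intro parity_poly_mult parity_poly_monom assms) simp
  moreover have "monom 1 n * r \<noteq> 0" using assms by simp
  then have "coeff (monom 1 n * r) (degree (monom 1 n * r)) \<noteq> 0" by simp
  ultimately show ?thesis
    using parity_poly_cong[of "n + 0"] by (auto simp: parity_poly_def)
qed

text \<open>The map \<open>p \<mapsto> t\<^sup>2 p'\<close> is the derivation of \<open>\<F>[t]\<close> that sends \<open>t\<close> to \<open>t\<^sup>2\<close>. Write
  \<open>p = t\<^sup>n r\<close> with \<open>r(0) \<noteq> 0\<close>. If \<open>p\<close> divides its image, then \<open>r\<close> divides \<open>r'\<close>, which has smaller
  degree; so \<open>r' = 0\<close>, and in characteristic 2 this makes \<open>r\<close> even.\<close>
lemma parity_poly_of_dvd_pderiv:
  fixes p :: "'a::field poly"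
  assumes char: "(2::'a) = 0" and "p \<noteq> 0" and dvd: "p dvd monom 1 2 * pderiv p"
  shows "parity_poly (degree p) p"
proof -
  obtain n r where p: "p = monom 1 n * r" and r: "coeff r 0 \<noteq> 0"
    using split_off_t[OF \<open>p \<noteq> 0\<close>] .
  have t: "monom 1 2 * pderiv (monom (1::'a) n) = monom 1 n * monom (of_nat n) 1"
    by (cases n) (simp_all add: pderiv_monom mult_monom)
  have "monom 1 2 * pderiv p
      = monom 1 n * (monom (of_nat n) 1 * r + monom 1 2 * pderiv r)"
    using t unfolding p pderiv_mult by (simp add: algebra_simps)
  then have "r dvd monom (of_nat n) 1 * r + monom 1 2 * pderiv r"
    using dvd \<open>p \<noteq> 0\<close> unfolding p by (simp add: dvd_mult_cancel_left)
  then have "r dvd monom 1 2 * pderiv r"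
    by (metis dvd_add_right_iff dvd_triv_right)
  then have "r dvd pderiv r" using r dvd_t_power_mult_cancel by blast
  have "pderiv r = 0"
  proof (rule ccontr)
    assume "pderiv r \<noteq> 0"
    then have "degree r \<le> degree (pderiv r)" using \<open>r dvd pderiv r\<close> dvd_imp_degree_le by blast
    moreover have "degree (pderiv r) \<le> degree r - 1"
      by (intro degree_le) (simp add: coeff_pderiv coeff_eq_0)
    ultimately have "degree r = 0" by linarith
    then show False using \<open>pderiv r \<noteq> 0\<close> by (metis degree_eq_zeroE pderiv_singleton)
  qed
  then have "parity_poly 0 r" using pderiv_zero_imp_even char by blast
  then show ?thesis unfolding p using r by (intro parity_poly_monom_mult) auto
qed

text \<open>The polynomial \<open>p(-t)\<close>.\<close>
definition reflect_var :: "'a::comm_ring_1 poly \<Rightarrow> 'a poly" where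
  "reflect_var p = pcompose p [:0, -1:]"

lemma reflect_var_0 [simp]: "reflect_var 0 = 0"
  by (simp add: reflect_var_def)

lemma reflect_var_mult: "reflect_var (p * q) = reflect_var p * reflect_var q"
  by (simp add: reflect_var_def pcompose_mult)

lemma reflect_var_pCons: "reflect_var (pCons a p) = pCons a (- reflect_var p)"
  by (simp add: reflect_var_def pcompose_pCons)

lemma coeff_reflect_var: "coeff (reflect_var p) n = (-1) ^ n * coeff p n"
proof (induction p arbitrary: n)
  case (pCons a p)
  then show ?case by (cases n) (simp_all add: reflect_var_pCons)
qed simp

lemma degree_reflect_var: "degree (reflect_var (p :: 'a::idom poly)) = degree p"
  by (simp add: reflect_var_def degree_pcompose)

text \<open>The counterpart in the other characteristics: with \<open>p = t\<^sup>n r\<close> as before, \<open>r\<close> divides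
  \<open>r(-t)\<close>, which has the same degree, and comparing constant terms gives \<open>r(-t) = r\<close>. The factor
  \<open>t\<^sup>2\<close> is harmless because it is coprime to \<open>r\<close>.\<close>
lemma parity_poly_of_dvd_reflect:
  fixes p :: "'a::field poly"
  assumes char: "(2::'a) \<noteq> 0" and "p \<noteq> 0" and dvd: "p dvd monom 1 2 * reflect_var p"
  shows "parity_poly (degree p) p"
proof -
  obtain n r where p: "p = monom 1 n * r" and r: "coeff r 0 \<noteq> 0"
    using split_off_t[OF \<open>p \<noteq> 0\<close>] .
  have r0: "r \<noteq> 0" using r by auto
  have mon: "reflect_var (monom 1 n) = smult ((-1) ^ n) (monom (1::'a) n)"
    by (intro poly_eqI) (simp add: coeff_reflect_var)
  have "monom 1 2 * reflect_var p = monom 1 n * (monom 1 2 * smult ((-1) ^ n) (reflect_var r))"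
    unfolding p reflect_var_mult mon by (simp add: algebra_simps)
  then have "r dvd monom 1 2 * smult ((-1) ^ n) (reflect_var r)"
    using dvd \<open>p \<noteq> 0\<close> unfolding p by (simp add: dvd_mult_cancel_left del: mult_smult_right)
  then have "r dvd smult ((-1) ^ n) (reflect_var r)"
    using r dvd_t_power_mult_cancel by blast
  then have "r dvd reflect_var r" by (simp add: dvd_smult_iff)
  then obtain k where k: "reflect_var r = r * k" by auto
  then have "k \<noteq> 0" using r0 degree_reflect_var[of r] coeff_reflect_var[of r 0] r by auto
  then have "degree k = 0"
    using k r0 degree_reflect_var[of r] by (simp add: degree_mult_eq)
  then obtain c where c: "k = [:c:]" by (metis degree_eq_zeroE)
  then have coeffs: "(-1) ^ i * coeff r i = c * coeff r i" for i
  proof -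
    have "(-1) ^ i * coeff r i = coeff (reflect_var r) i" by (simp only: coeff_reflect_var)
    then show ?thesis by (simp add: k c)
  qed
  then have "c = 1" using r coeffs[of 0] by simp
  have "parity_poly 0 r"
    unfolding parity_poly_def
  proof (intro allI impI)
    fix i assume nz: "coeff r i \<noteq> 0"
    show "even (i + 0)"
    proof (rule ccontr)
      assume "odd (i + 0)"
      then have "- coeff r i = coeff r i" using coeffs[of i] unfolding \<open>c = 1\<close> by simp
      then have "2 * coeff r i = 0" by (metis add.right_inverse mult_2)
      then show False using nz char by simp
    qed
  qed
  then show ?thesis unfolding p using r0 by (intro parity_poly_monom_mult)
qed

section \<open>The residue pairing modulo a polynomial\<close>

text \<open>For nonconstant \<open>m\<close> this linear functional makes \<open>\<F>[t]/(m)\<close> a Frobenius algebra: the bilinear form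
  \<open>(f, g) \<mapsto> top_residue m (f * g)\<close> is nondegenerate on it.\<close>
definition top_residue :: "'a::field poly \<Rightarrow> 'a poly \<Rightarrow> 'a" where
  "top_residue m f = coeff (f mod m) (degree m - 1)"

lemma top_residue_add: "top_residue m (f + g) = top_residue m f + top_residue m g"
  by (simp add: top_residue_def poly_mod_add_left)

lemma top_residue_smult: "top_residue m (smult c f) = c * top_residue m f"
  by (simp add: top_residue_def mod_smult_left)

lemma top_residue_dvd: "m dvd f \<Longrightarrow> top_residue m f = 0"
  by (simp add: top_residue_def dvd_imp_mod_0)

text \<open>If \<open>m\<close> and \<open>f\<close> both have the parity of \<open>d = degree m\<close>, then so has \<open>f mod m\<close>, and its
  coefficient of index \<open>d - 1\<close> has the wrong parity to be nonzero.\<close>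
lemma top_residue_parity:
  assumes "parity_poly (degree m) m" "degree m > 0" "parity_poly (degree m) f"
  shows "top_residue m f = 0"
  using parity_poly_mod[OF assms(1) assms(3)] assms(2)
  unfolding top_residue_def parity_poly_def
  by (metis One_nat_def Suc_pred add_Suc even_Suc even_add)

text \<open>Multiplying a nonzero remainder by a suitable power of \<open>t\<close> raises its degree to exactly
  \<open>degree m - 1\<close>, so that the functional reads off its leading coefficient.\<close>
lemma top_residue_nondegenerate:
  assumes "degree m > 0" "\<And>h. top_residue m (f * h) = 0"
  shows "m dvd f"
proof (rule ccontr)
  assume "\<not> m dvd f"
  define r where "r = f mod m"
  have r: "r \<noteq> 0" "degree r < degree m"
    using \<open>\<not> m dvd f\<close> assms(1) degree_mod_less[of m f]
    unfolding r_def dvd_eq_mod_eq_0 by fastforce+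
  define h :: "'a poly" where "h = monom 1 (degree m - 1 - degree r)"
  have deg: "degree (r * h) = degree m - 1"
    using r by (simp add: h_def degree_mult_eq degree_monom_eq)
  have "(f * h) mod m = (r * h) mod m" by (simp add: r_def mod_mult_left_eq)
  also have "\<dots> = r * h" using deg assms(1) by (intro mod_poly_less) simp
  finally have "top_residue m (f * h) = lead_coeff (r * h)"
    by (simp add: top_residue_def deg)
  also have "\<dots> \<noteq> 0" using r by (simp add: h_def)
  finally show False using assms(2) by simp
qed

text \<open>In the basis \<open>1, t, \<dots>, t\<^sup>d\<^sup>-\<^sup>1\<close> the matrix of the pairing is antitriangular with ones on
  the antidiagonal, so the coefficients of a representing polynomial can be found one at a time.\<close>
lemma top_residue_represents:
  fixes l :: "'a::field poly \<Rightarrow> 'a"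
  assumes deg: "degree m > 0"
    and add: "\<And>f g. l (f + g) = l f + l g"
    and smult: "\<And>c f. l (smult c f) = c * l f"
    and m: "\<And>f. l (m * f) = 0"
  obtains g where "\<And>f. l f = top_residue m (f * g)"
proof -
  have "\<exists>g. \<forall>i<k. l (monom 1 i) = top_residue m (monom 1 i * g)" if "k \<le> degree m" for k
    using that
  proof (induction k)
    case (Suc k)
    then obtain g where g: "\<And>i. i < k \<Longrightarrow> l (monom 1 i) = top_residue m (monom 1 i * g)"
      by (meson Suc_leD)
    \<comment> \<open>Adding a multiple of \<open>t\<close> to the power \<open>degree m - 1 - k\<close> corrects the value at \<open>monom 1 k\<close>
      and leaves the values at lower monomials unchanged.\<close>
    define c where "c = l (monom 1 k) - top_residue m (monom 1 k * g)"
    define h :: "'a poly" where "h = monom c (degree m - 1 - k)"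
    have h: "top_residue m (monom 1 i * h) = (if i = k then c else 0)" if "i \<le> k" for i
    proof -
      have eq: "monom 1 i * h = monom c (i + (degree m - 1 - k))"
        by (simp add: h_def mult_monom)
      have "degree (monom 1 i * h) < degree m"
        unfolding eq using that Suc.prems by (intro le_less_trans[OF degree_monom_le]) linarith
      then have "top_residue m (monom 1 i * h) = coeff (monom 1 i * h) (degree m - 1)"
        by (simp add: top_residue_def mod_poly_less)
      also have "\<dots> = (if i = k then c else 0)"
        unfolding eq using that Suc.prems by auto
      finally show ?thesis .
    qed
    have "\<forall>i<Suc k. l (monom 1 i) = top_residue m (monom 1 i * (g + h))"
    proof (intro allI impI)
      fix i assume i: "i < Suc k"
      show "l (monom 1 i) = top_residue m (monom 1 i * (g + h))"
        using i g[of i] h[of i] by (cases "i = k") (auto simp: algebra_simps top_residue_add c_def)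
    qed
    then show ?case by blast
  qed simp
  from this[of "degree m"] obtain g
    where g: "\<And>i. i < degree m \<Longrightarrow> l (monom 1 i) = top_residue m (monom 1 i * g)" by auto
  have "l 0 = 0" using m[of 0] by simp
  have lsum: "l (sum F S) = (\<Sum>i\<in>S. l (F i))" for F and S :: "nat set"
    using \<open>l 0 = 0\<close> add by (induction S rule: infinite_finite_induct) auto
  have rsum: "top_residue m (sum F S) = (\<Sum>i\<in>S. top_residue m (F i))" for F and S :: "nat set"
    by (induction S rule: infinite_finite_induct) (auto simp: top_residue_add top_residue_dvd)
  have "l f = top_residue m (f * g)" for f
  proof -
    define r where "r = f mod m"
    have f: "f = m * (f div m) + r" by (simp add: r_def)
    have "degree r < degree m"
      using degree_mod_less[of m f] deg unfolding r_def by fastforce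
    then have r: "r = (\<Sum>i\<le>degree m - 1. smult (coeff r i) (monom 1 i))"
      using poly_as_sum_of_monoms'[of r "degree m - 1"] by (simp add: smult_monom)
    have "l f = l r" using f add m by (metis add_0)
    also have "\<dots> = (\<Sum>i\<le>degree m - 1. coeff r i * l (monom 1 i))"
      by (subst r) (simp add: lsum smult)
    also have "\<dots> = (\<Sum>i\<le>degree m - 1. coeff r i * top_residue m (monom 1 i * g))"
      using g deg by (intro sum.cong) auto
    also have "\<dots> = top_residue m ((\<Sum>i\<le>degree m - 1. smult (coeff r i) (monom 1 i)) * g)"
      by (simp add: rsum sum_distrib_right top_residue_smult)
    also have "\<dots> = top_residue m (r * g)" by (simp only: r [symmetric])
    also have "\<dots> = top_residue m (m * (f div m) * g + r * g)"
      by (simp add: top_residue_add top_residue_dvd mult.assoc)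
    also have "\<dots> = top_residue m (f * g)" using f by (metis distrib_right)
    finally show ?thesis .
  qed
  then show thesis using that by blast
qed

section \<open>Relations between vectors of polynomials\<close>

text \<open>More vectors than coordinates are linearly dependent, over an integral domain by elimination
  without denominators.\<close>
lemma polynomial_relation:
  fixes a :: "nat \<Rightarrow> nat \<Rightarrow> 'a::idom"
  shows "\<exists>l. (\<exists>j\<le>k. l j \<noteq> 0) \<and> (\<forall>i<k. (\<Sum>j\<le>k. l j * a j i) = 0)"
proof (induction k arbitrary: a)
  case 0
  show ?case by (rule exI[of _ "\<lambda>_. 1"]) simp
next
  case (Suc k)
  show ?case
  proof (cases "\<exists>p\<le>Suc k. a p k \<noteq> 0")
    case False
    from Suc[of a] obtain l where l: "\<exists>j\<le>k. l j \<noteq> 0" "\<And>i. i < k \<Longrightarrow> (\<Sum>j\<le>k. l j * a j i) = 0"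
      by auto
    let ?l = "l(Suc k := 0)"
    have "(\<Sum>j\<le>Suc k. ?l j * a j i) = 0" if "i < Suc k" for i
    proof (cases "i = k")
      case True
      then show ?thesis using False by (auto intro!: sum.neutral)
    next
      case i: False
      have "(\<Sum>j\<le>k. ?l j * a j i) = (\<Sum>j\<le>k. l j * a j i)" by (rule sum.cong) auto
      then show ?thesis using l(2)[of i] that i by simp
    qed
    moreover have "\<exists>j\<le>Suc k. ?l j \<noteq> 0"
      using l(1) by (metis fun_upd_apply le_SucI not_less_eq_eq)
    ultimately show ?thesis by blast
  next
    case True
    then obtain p where p: "p \<le> Suc k" "a p k \<noteq> 0" by blast
    \<comment> \<open>The row \<open>p\<close> is the pivot; \<open>\<tau>\<close> enumerates the other rows, and \<open>c\<close> is the matrix that is left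
      after their entries in the last column have been eliminated.\<close>
    define \<tau> where "\<tau> j = (if j < p then j else Suc j)" for j
    have bij: "bij_betw \<tau> {..k} ({..Suc k} - {p})"
    proof (rule bij_betwI[of _ _ _ "\<lambda>j. if j < p then j else j - 1"])
    qed (use p in \<open>auto simp: \<tau>_def split: if_splits\<close>)
    define c where "c j i = a p k * a (\<tau> j) i - a (\<tau> j) k * a p i" for j i
    from Suc[of c] obtain l where l: "\<exists>j\<le>k. l j \<noteq> 0" "\<And>i. i < k \<Longrightarrow> (\<Sum>j\<le>k. l j * c j i) = 0"
      by auto
    define \<sigma> where "\<sigma> = inv_into {..k} \<tau>"
    have \<sigma>: "\<sigma> (\<tau> j) = j" if "j \<le> k" for j
      using bij that by (simp add: \<sigma>_def bij_betw_inv_into_left)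
    let ?l = "\<lambda>j. if j = p then - (\<Sum>j\<le>k. l j * a (\<tau> j) k) else a p k * l (\<sigma> j)"
    have ne: "\<tau> j \<noteq> p" for j by (auto simp: \<tau>_def)
    have "(\<Sum>j\<le>Suc k. ?l j * a j i) = (\<Sum>j\<le>k. l j * c j i)" for i
    proof -
      have "(\<Sum>j\<le>Suc k. ?l j * a j i) = ?l p * a p i + (\<Sum>j\<in>{..Suc k} - {p}. ?l j * a j i)"
        using p by (subst sum.remove[of _ p]) auto
      also have "(\<Sum>j\<in>{..Suc k} - {p}. ?l j * a j i) = (\<Sum>j\<le>k. ?l (\<tau> j) * a (\<tau> j) i)"
        by (rule sum.reindex_bij_betw[OF bij, symmetric])
      also have "\<dots> = (\<Sum>j\<le>k. a p k * l j * a (\<tau> j) i)"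
        by (rule sum.cong) (auto simp: ne \<sigma>)
      finally show ?thesis
        by (simp add: c_def sum_distrib_right sum_distrib_left sum_subtractf algebra_simps)
    qed
    moreover have "(\<Sum>j\<le>k. l j * c j i) = 0" if "i < Suc k" for i
      using l(2)[of i] that by (cases "i = k") (auto simp: c_def)
    moreover have "\<exists>j\<le>Suc k. ?l j \<noteq> 0"
    proof -
      obtain j where j: "j \<le> k" "l j \<noteq> 0" using l(1) by blast
      have "?l (\<tau> j) \<noteq> 0" using j p ne \<sigma> by simp
      moreover have "\<tau> j \<le> Suc k" using j by (simp add: \<tau>_def)
      ultimately show ?thesis by blast
    qed
    ultimately show ?thesis by (intro exI[of _ ?l]) auto
  qed
qed

section \<open>Operators and cyclic decompositions\<close>

locale linear_operator = finite_dimensional_vector_space scale Basis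
  for scale :: "'a::field \<Rightarrow> 'v::ab_group_add \<Rightarrow> 'v" and Basis +
  fixes u :: "'v \<Rightarrow> 'v"
  assumes linear_u: "Vector_Spaces.linear scale scale u"
begin

abbreviation act :: "'a poly \<Rightarrow> 'v \<Rightarrow> 'v" (infixr \<open>\<cdot>\<close> 75) where
  "p \<cdot> x \<equiv> poly_action scale u p x"

sublocale u: Vector_Spaces.linear scale scale u
  by (rule linear_u)

lemma act_eq_sum:
  assumes "degree p \<le> n"
  shows "p \<cdot> x = (\<Sum>i\<le>n. scale (coeff p i) ((u ^^ i) x))"
  unfolding poly_action_def
  using assms by (intro sum.mono_neutral_left) (auto simp: coeff_eq_0)

lemma act_0 [simp]: "0 \<cdot> x = 0"
  by (simp add: poly_action_def)

lemma act_pCons: "pCons a p \<cdot> x = scale a x + u (p \<cdot> x)"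
proof -
  have "pCons a p \<cdot> x = (\<Sum>i\<le>Suc (degree p). scale (coeff (pCons a p) i) ((u ^^ i) x))"
    by (rule act_eq_sum) (rule degree_pCons_le)
  then show ?thesis
    by (simp add: sum.atMost_Suc_shift poly_action_def u.sum u.scale del: sum.atMost_Suc)
qed

lemma act_add_left: "(p + q) \<cdot> x = p \<cdot> x + q \<cdot> x"
  using act_eq_sum[of "p + q" "max (degree p) (degree q)" x]
    act_eq_sum[of p "max (degree p) (degree q)" x] act_eq_sum[of q "max (degree p) (degree q)" x]
  by (simp add: degree_add_le scale_left_distrib sum.distrib)

lemma act_add_right: "p \<cdot> (x + y) = p \<cdot> x + p \<cdot> y"
  by (induction p) (simp_all add: act_pCons u.add scale_right_distrib)

lemma act_zero_right [simp]: "p \<cdot> 0 = 0"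
  using act_add_right[of p 0 0] by simp

lemma act_u: "p \<cdot> u x = u (p \<cdot> x)"
  by (induction p) (simp_all add: act_pCons u.add u.scale u.zero)

lemma act_smult: "smult c p \<cdot> x = scale c (p \<cdot> x)"
  by (induction p) (simp_all add: act_pCons u.scale scale_right_distrib)

lemma act_mult: "(p * q) \<cdot> x = p \<cdot> q \<cdot> x"
  by (induction p) (simp_all add: act_pCons act_add_left act_smult)

lemma act_commute: "p \<cdot> q \<cdot> x = q \<cdot> p \<cdot> x"
  by (metis act_mult mult.commute)

lemma act_const [simp]: "[:c:] \<cdot> x = scale c x"
  by (simp add: act_pCons u.zero)

lemma act_1 [simp]: "1 \<cdot> x = x"
  by (simp add: one_pCons)

lemma act_monom: "monom c n \<cdot> x = scale c ((u ^^ n) x)"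
  by (induction n) (simp_all add: monom_0 monom_Suc act_pCons u.scale)

lemma act_square_mult: "(monom 1 2 * q) \<cdot> x = u (u (q \<cdot> x))"
  by (simp add: act_mult act_monom numeral_2_eq_2)

lemma act_uminus_left: "(- p) \<cdot> x = - (p \<cdot> x)"
  using act_add_left[of "- p" p x] by (simp add: eq_neg_iff_add_eq_0)

lemma act_diff_left: "(p - q) \<cdot> x = p \<cdot> x - q \<cdot> x"
  using act_add_left[of p "- q" x] by (simp add: act_uminus_left)

lemma act_sum_left: "(sum f I) \<cdot> x = (\<Sum>i\<in>I. f i \<cdot> x)"
  by (induction I rule: infinite_finite_induct) (simp_all add: act_add_left)

lemma act_sum_right: "p \<cdot> (sum f I) = (\<Sum>i\<in>I. p \<cdot> f i)"
  by (induction I rule: infinite_finite_induct) (simp_all add: act_add_right)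

lemma act_dvd_zero: "p \<cdot> x = 0 \<Longrightarrow> p dvd q \<Longrightarrow> q \<cdot> x = 0"
  by (metis act_mult act_zero_right dvd_def mult.commute)

definition combination :: "nat \<Rightarrow> 'v list \<Rightarrow> (nat \<Rightarrow> 'a poly) \<Rightarrow> 'v" where
  "combination n zs f = (\<Sum>i<n. f i \<cdot> zs ! i)"

text \<open>The vectors \<open>zs\<close> generate \<open>W\<close> as a module, and all relations between them follow from
  \<open>ps ! i \<cdot> zs ! i = 0\<close>. In other words \<open>W\<close> is the direct sum of the cyclic modules generated by the
  \<open>zs ! i\<close>, and \<open>ps ! i\<close> is the order of \<open>zs ! i\<close>.\<close>
definition cyclic_basis :: "'v set \<Rightarrow> 'a poly list \<Rightarrow> 'v list \<Rightarrow> bool" where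
  "cyclic_basis W ps zs \<longleftrightarrow> length zs = length ps \<and>
     W = range (combination (length ps) zs) \<and>
     (\<forall>f. combination (length ps) zs f = 0 \<longleftrightarrow> (\<forall>i<length ps. ps ! i dvd f i))"

lemma combination_add:
  "combination n zs (\<lambda>i. f i + g i) = combination n zs f + combination n zs g"
  by (simp add: combination_def act_add_left sum.distrib)

lemma combination_diff:
  "combination n zs (\<lambda>i. f i - g i) = combination n zs f - combination n zs g"
  by (simp add: combination_def act_diff_left sum_subtractf)

lemma combination_mult:
  "combination n zs (\<lambda>i. p * f i) = p \<cdot> combination n zs f"
  by (simp add: combination_def act_mult act_sum_right)

lemma combination_single:
  assumes "k < n"
  shows "combination n zs (\<lambda>i. if i = k then h else 0) = h \<cdot> zs ! k"
proof -
  have "combination n zs (\<lambda>i. if i = k then h else 0) = (\<Sum>i<n. if i = k then h \<cdot> zs ! k else 0)"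
    unfolding combination_def by (rule sum.cong) auto
  then show ?thesis using assms by simp
qed

lemma cyclic_basis_eq_iff:
  assumes "cyclic_basis W ps zs"
  shows "combination (length ps) zs f = combination (length ps) zs g
    \<longleftrightarrow> (\<forall>i<length ps. f i mod ps ! i = g i mod ps ! i)"
proof -
  have "combination (length ps) zs f = combination (length ps) zs g
    \<longleftrightarrow> combination (length ps) zs (\<lambda>i. f i - g i) = 0"
    by (simp add: combination_diff)
  then show ?thesis
    using assms by (simp add: cyclic_basis_def mod_eq_dvd_iff)
qed

text \<open>The isomorphism sends a vector to the reduced coordinates of any of its expansions.\<close>
lemma cyclic_basis_imp_isomorphic:
  assumes basis: "cyclic_basis UNIV ps zs"
  shows "isomorphic_to_cyclic_sum scale u ps"
proof -
  let ?n = "length ps"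
  let ?P = "\<Pi>\<^sub>E i\<in>{..<?n}. poly_residues (ps ! i)"
  let ?S = "combination ?n zs"
  note eq_iff = cyclic_basis_eq_iff[OF basis]
  have red: "?S (restrict (\<lambda>i. f i mod ps ! i) {..<?n}) = ?S f" for f
    by (subst eq_iff) simp
  have red_mem: "restrict (\<lambda>i. f i mod ps ! i) {..<?n} \<in> ?P" for f
    by (auto simp: poly_residues_def)
  have "inj_on ?S ?P"
  proof (rule inj_onI)
    fix f g assume f: "f \<in> ?P" and g: "g \<in> ?P" and "?S f = ?S g"
    then have "\<forall>i<?n. f i mod ps ! i = g i mod ps ! i" by (simp add: eq_iff)
    then have "f i = g i" if "i \<in> {..<?n}" for i
      using f g that by (auto simp: poly_residues_def PiE_def Pi_def)
    then show "f = g" using f g by (rule PiE_ext[rotated 2])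
  qed
  moreover have "?S ` ?P = UNIV"
  proof -
    have "x \<in> ?S ` ?P" for x
    proof -
      obtain f where "x = ?S f"
        using basis unfolding cyclic_basis_def by blast
      then have "x = ?S (restrict (\<lambda>i. f i mod ps ! i) {..<?n})" by (simp add: red)
      then show ?thesis using red_mem by (rule image_eqI)
    qed
    then show ?thesis by blast
  qed
  ultimately have bij: "bij_betw ?S ?P UNIV" by (simp add: bij_betw_def)
  define \<phi> where "\<phi> = inv_into ?P ?S"
  have \<phi>: "bij_betw \<phi> UNIV ?P"
    unfolding \<phi>_def using bij by (rule bij_betw_inv_into)
  have S\<phi>: "?S (\<phi> x) = x" for x
    unfolding \<phi>_def using bij by (simp add: bij_betw_inv_into_right)
  have \<phi>S: "\<phi> (?S f) i = f i mod ps ! i" if "i < ?n" for f i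
  proof -
    have "\<phi> (?S f) = restrict (\<lambda>i. f i mod ps ! i) {..<?n}"
      unfolding \<phi>_def using bij_betw_inv_into_left[OF bij red_mem[of f]] red[of f] by simp
    then show ?thesis using that by simp
  qed
  have "\<phi> (x + y) i = (\<phi> x i + \<phi> y i) mod ps ! i" if "i < ?n" for x y i
    using \<phi>S[OF that, of "\<lambda>i. \<phi> x i + \<phi> y i"] by (simp add: combination_add S\<phi>)
  moreover have "\<phi> (q \<cdot> x) i = (q * \<phi> x i) mod ps ! i" if "i < ?n" for q x i
    using \<phi>S[OF that, of "\<lambda>i. q * \<phi> x i"] by (simp add: combination_mult S\<phi>)
  ultimately show ?thesis
    unfolding isomorphic_to_cyclic_sum_def using \<phi> by blast
qed

text \<open>The generators are the preimages of the tuples with a single entry 1 (reduced, in case the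
  modulus is constant).\<close>
lemma isomorphic_imp_cyclic_basis:
  assumes "isomorphic_to_cyclic_sum scale u ps"
  obtains zs where "cyclic_basis UNIV ps zs"
proof -
  let ?n = "length ps"
  let ?P = "\<Pi>\<^sub>E i\<in>{..<?n}. poly_residues (ps ! i)"
  obtain \<phi> where bij: "bij_betw \<phi> UNIV ?P"
    and add: "\<And>x y i. i < ?n \<Longrightarrow> \<phi> (x + y) i = (\<phi> x i + \<phi> y i) mod ps ! i"
    and act: "\<And>q x i. i < ?n \<Longrightarrow> \<phi> (q \<cdot> x) i = (q * \<phi> x i) mod ps ! i"
    using assms unfolding isomorphic_to_cyclic_sum_def by blast
  have zero: "\<phi> 0 i = 0" if "i < ?n" for i
    using act[OF that, of 0 0] by simp
  have ext: "x = y" if "\<And>i. i < ?n \<Longrightarrow> \<phi> x i = \<phi> y i" for x y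
  proof -
    have "\<phi> x \<in> ?P" "\<phi> y \<in> ?P" using bij by (auto simp: bij_betw_def)
    then have "\<phi> x = \<phi> y" using that by (intro PiE_ext) auto
    then show ?thesis using bij by (auto simp: bij_betw_def dest: injD)
  qed
  define e where "e j = restrict (\<lambda>i. if i = j then 1 mod ps ! i else 0) {..<?n}" for j
  have "e j \<in> ?P" for j by (auto simp: e_def poly_residues_def)
  then have "\<exists>z. \<phi> z = e j" for j
    using bij unfolding bij_betw_def by (metis UNIV_I imageE)
  then obtain z where z: "\<And>j. \<phi> (z j) = e j" by metis
  define zs where "zs = map z [0..<?n]"
  have partial: "\<phi> (\<Sum>j<k. f j \<cdot> z j) i = (\<Sum>j<k. f j * e j i) mod ps ! i"
    if "i < ?n" for f k i
    using that by (induction k) (simp_all add: zero add act z mod_add_eq)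
  have comb: "\<phi> (combination ?n zs f) i = f i mod ps ! i" if i: "i < ?n" for f i
  proof -
    have "combination ?n zs f = (\<Sum>j<?n. f j \<cdot> z j)"
      unfolding combination_def zs_def by (rule sum.cong) auto
    moreover have "(\<Sum>j<?n. f j * e j i) = (\<Sum>j<?n. if j = i then f i * (1 mod ps ! i) else 0)"
      by (rule sum.cong) (auto simp: e_def i)
    ultimately show ?thesis using partial[OF i, of f ?n] i by (simp add: mod_mult_right_eq)
  qed
  have "x = combination ?n zs (\<phi> x)" for x
  proof (rule ext)
    fix i assume i: "i < ?n"
    have "\<phi> x \<in> ?P" using bij by (auto simp: bij_betw_def)
    then have "\<phi> x i mod ps ! i = \<phi> x i"
      using i unfolding PiE_def Pi_def poly_residues_def by blast
    then show "\<phi> x i = \<phi> (combination ?n zs (\<phi> x)) i" using comb[OF i] by simp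
  qed
  moreover have "combination ?n zs f = 0 \<longleftrightarrow> (\<forall>i<?n. ps ! i dvd f i)" for f
  proof
    assume "combination ?n zs f = 0"
    then show "\<forall>i<?n. ps ! i dvd f i" using comb[of _ f] zero by (simp add: dvd_eq_mod_eq_0)
  next
    assume "\<forall>i<?n. ps ! i dvd f i"
    then show "combination ?n zs f = 0"
      using comb[of _ f] zero by (intro ext) (simp add: dvd_eq_mod_eq_0)
  qed
  ultimately have "cyclic_basis UNIV ps zs"
    unfolding cyclic_basis_def by (auto simp: zs_def)
  then show thesis by (rule that)
qed

lemma cyclic_basis_Nil: "cyclic_basis {0} [] []"
  by (auto simp: cyclic_basis_def combination_def)

lemma cyclic_basis_Cons:
  assumes basis: "cyclic_basis W ps zs"
    and V: "V = {f \<cdot> z + w | f w. w \<in> W}"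
    and indep: "\<And>f w. w \<in> W \<Longrightarrow> f \<cdot> z + w = 0 \<longleftrightarrow> p dvd f \<and> w = 0"
  shows "cyclic_basis V (p # ps) (z # zs)"
proof -
  let ?n = "length ps"
  have W: "W = range (combination ?n zs)" and len: "length zs = ?n"
    and zero: "\<And>f. combination ?n zs f = 0 \<longleftrightarrow> (\<forall>i<?n. ps ! i dvd f i)"
    using basis by (auto simp: cyclic_basis_def)
  have comb: "combination (Suc ?n) (z # zs) f = f 0 \<cdot> z + combination ?n zs (\<lambda>i. f (Suc i))" for f
    by (simp add: combination_def sum.lessThan_Suc_shift del: sum.lessThan_Suc)
  have "V = range (combination (Suc ?n) (z # zs))"
  proof (intro equalityI subsetI)
    fix v assume "v \<in> V"
    then obtain f g where "v = f \<cdot> z + combination ?n zs g" by (auto simp: V W)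
    then have "v = combination (Suc ?n) (z # zs) (case_nat f g)" by (simp add: comb)
    then show "v \<in> range (combination (Suc ?n) (z # zs))" by blast
  next
    fix v assume "v \<in> range (combination (Suc ?n) (z # zs))"
    then show "v \<in> V" unfolding V W comb by auto
  qed
  moreover have "combination (Suc ?n) (z # zs) f = 0 \<longleftrightarrow> (\<forall>i<Suc ?n. (p # ps) ! i dvd f i)" for f
    unfolding comb using indep[of "combination ?n zs (\<lambda>i. f (Suc i))" "f 0"] zero W
    by (auto simp: All_less_Suc2)
  ultimately show ?thesis by (simp add: cyclic_basis_def len)
qed

section \<open>Twisted commutation and invariant factors\<close>

text \<open>The hypothesis on \<open>a\<close> says, in characteristic 2, that the commutator of \<open>a\<close> and \<open>u\<close> is \<open>u\<^sup>2\<close>.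
  Commuting with \<open>a\<close> is a derivation, so on polynomials in \<open>u\<close> it acts as the derivation with
  \<open>t \<mapsto> t\<^sup>2\<close>.\<close>
lemma derivation_act:
  assumes add: "\<And>x y. a (x + y) = a x + a y" and scale: "\<And>c x. a (scale c x) = scale c (a x)"
    and char: "(2::'a) = 0"
    and a: "\<And>x. u (a x) + a (u x) = u (u x)"
  shows "a (p \<cdot> x) = (monom 1 2 * pderiv p) \<cdot> x + p \<cdot> a x"
proof (induction p)
  case 0
  show ?case using scale[of 0 0] by simp
next
  case (pCons c p)
  have neg: "- y = y" for y :: 'v
  proof -
    have "y + y = scale 2 y" by (metis one_add_one scale_left_distrib scale_one)
    then show ?thesis using char by (simp add: neg_eq_iff_add_eq_0)
  qed
  have a': "a (u y) = u (u y) + u (a y)" for y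
    using a[of y] neg[of "u (a y)"] by (metis add.commute add_diff_cancel_left' diff_conv_add_uminus)
  show ?case
    unfolding act_square_mult
    by (simp add: pCons.IH[unfolded act_square_mult] pderiv_pCons act_pCons act_add_left
        add scale a' u.add u.zero ac_simps)
qed

text \<open>Apply \<open>a\<close> to the relation \<open>ps ! k \<cdot> zs ! k = 0\<close> and read off the coordinate \<open>k\<close>.\<close>
lemma cyclic_basis_derivation:
  assumes basis: "cyclic_basis UNIV ps zs" and k: "k < length ps"
    and add: "\<And>x y. a (x + y) = a x + a y" and scale: "\<And>c x. a (scale c x) = scale c (a x)"
    and char: "(2::'a) = 0"
    and a: "\<And>x. u (a x) + a (u x) = u (u x)"
  shows "ps ! k dvd monom 1 2 * pderiv (ps ! k)"
proof -
  let ?n = "length ps" and ?p = "ps ! k"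
  let ?d = "monom 1 2 * pderiv ?p"
  have zero: "\<And>f. combination ?n zs f = 0 \<longleftrightarrow> (\<forall>i<?n. ps ! i dvd f i)"
    using basis by (auto simp: cyclic_basis_def)
  obtain f where f: "a (zs ! k) = combination ?n zs f"
    using basis unfolding cyclic_basis_def by (metis UNIV_I imageE)
  have "?p \<cdot> zs ! k = 0"
    using zero[of "\<lambda>i. if i = k then ?p else 0"] by (simp add: combination_single k)
  then have "0 = a (?p \<cdot> zs ! k)" using scale[of 0 0] by simp
  also have "\<dots> = ?d \<cdot> zs ! k + ?p \<cdot> a (zs ! k)"
    by (rule derivation_act[OF add scale char a])
  also have "\<dots> = combination ?n zs (\<lambda>i. (if i = k then ?d else 0) + ?p * f i)"
    by (simp only: f combination_add combination_mult combination_single[OF k])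
  finally have "?p dvd ?d + ?p * f k" using zero k by fastforce
  then show ?thesis by (metis dvd_add_left_iff dvd_triv_left)
qed

lemma anticommuting_act:
  assumes add: "\<And>x y. c (x + y) = c x + c y" and scale: "\<And>r x. c (scale r x) = scale r (c x)"
    and c: "\<And>x. c (u x) = - u (c x)"
  shows "c (p \<cdot> x) = reflect_var p \<cdot> c x"
proof (induction p)
  case 0
  show ?case using scale[of 0 0] by simp
next
  case (pCons r p)
  then show ?case
    by (simp add: act_pCons reflect_var_pCons add scale c act_uminus_left u.neg)
qed

text \<open>Put \<open>p = ps ! k\<close>. The chain of divisibilities makes \<open>p\<close> kill all generators from index \<open>k\<close>
  on, so \<open>p \<cdot> V\<close> is generated by \<open>k\<close> vectors. As \<open>c\<close> turns \<open>p\<close> into \<open>p(-t)\<close> and its image contains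
  \<open>u\<^sup>2 V\<close>, the submodule \<open>t\<^sup>2 p(-t) \<cdot> V\<close> is contained in one with \<open>k\<close> generators. The \<open>k + 1\<close> vectors
  \<open>t\<^sup>2 p(-t) \<cdot> zs ! j\<close>, \<open>j \<le> k\<close>, therefore satisfy a relation with nonzero coefficients \<open>l j\<close>, and the
  direct sum decomposition shows that \<open>p\<close> divides every \<open>l j * t\<^sup>2 p(-t)\<close>. If \<open>p\<close> did not divide
  \<open>t\<^sup>2 p(-t)\<close>, all coefficients would have a common nonconstant factor, and cancelling it would
  contradict a choice of the relation with least total degree.\<close>
lemma cyclic_basis_anticommuting:
  assumes basis: "cyclic_basis UNIV ps zs" and k: "k < length ps"
    and chain: "\<And>i. Suc i < length ps \<Longrightarrow> ps ! Suc i dvd ps ! i"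
    and nz: "ps ! k \<noteq> 0"
    and add: "\<And>x y. c (x + y) = c x + c y" and scale: "\<And>r x. c (scale r x) = scale r (c x)"
    and c: "\<And>x. c (u x) = - u (c x)"
    and onto: "\<And>x. \<exists>y. u (u x) = c y"
  shows "ps ! k dvd monom 1 2 * reflect_var (ps ! k)"
proof (rule ccontr)
  let ?n = "length ps" and ?p = "ps ! k"
  let ?h = "monom 1 2 * reflect_var ?p"
  assume ndvd: "\<not> ?p dvd ?h"
  have zero: "\<And>f. combination ?n zs f = 0 \<longleftrightarrow> (\<forall>i<?n. ps ! i dvd f i)"
    using basis by (auto simp: cyclic_basis_def)
  have chain': "ps ! i dvd ps ! j" if "j \<le> i" "i < ?n" for i j
    using that
  proof (induction i rule: dec_induct)
    case (step i)
    then show ?case using chain[of i] dvd_trans by force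
  qed simp
  have c_sum: "c (sum f S) = (\<Sum>i\<in>S. c (f i))" for f and S :: "nat set"
    using add scale[of 0 0] by (induction S rule: infinite_finite_induct) auto
  define w where "w i = c (?p \<cdot> zs ! i)" for i
  have "\<exists>a. \<forall>j. ?h \<cdot> zs ! j = (\<Sum>i<k. a j i \<cdot> w i)"
  proof -
    have "\<exists>a. ?h \<cdot> zs ! j = (\<Sum>i<k. a i \<cdot> w i)" for j
    proof -
      obtain y where y: "u (u (zs ! j)) = c y" using onto by blast
      obtain f where f: "y = combination ?n zs f"
        using basis unfolding cyclic_basis_def by (metis UNIV_I imageE)
      have "?h \<cdot> zs ! j = reflect_var ?p \<cdot> c y"
        by (simp only: act_square_mult act_u[symmetric] y)
      also have "\<dots> = c (?p \<cdot> y)" by (rule anticommuting_act[OF add scale c, symmetric])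
      also have "?p \<cdot> y = (\<Sum>i<?n. (?p * f i) \<cdot> zs ! i)"
        unfolding f combination_mult[symmetric] by (simp add: combination_def)
      also have "\<dots> = (\<Sum>i<k. (?p * f i) \<cdot> zs ! i)"
      proof (rule sum.mono_neutral_right)
        show "\<forall>i\<in>{..<?n} - {..<k}. (?p * f i) \<cdot> zs ! i = 0"
        proof
          fix i assume i: "i \<in> {..<?n} - {..<k}"
          have "ps ! i dvd ?p * f i" using chain'[of k i] i by auto
          then show "(?p * f i) \<cdot> zs ! i = 0"
            using zero[of "\<lambda>l. if l = i then ?p * f i else 0"] i by (simp add: combination_single)
        qed
      qed (use k in auto)
      also have "c \<dots> = (\<Sum>i<k. reflect_var (f i) \<cdot> w i)"
        unfolding c_sum w_def anticommuting_act[OF add scale c, symmetric]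
        by (simp only: act_mult[symmetric] mult.commute)
      finally show ?thesis by (rule exI[of _ "\<lambda>i. reflect_var (f i)"])
    qed
    then show ?thesis by metis
  qed
  then obtain a where a: "\<And>j. ?h \<cdot> zs ! j = (\<Sum>i<k. a j i \<cdot> w i)" by blast
  define rel where "rel l \<longleftrightarrow> (\<exists>j\<le>k. l j \<noteq> 0) \<and> (\<forall>i<k. (\<Sum>j\<le>k. l j * a j i) = 0)" for l
  have kills: "?p dvd l j * ?h" if l: "rel l" and j: "j \<le> k" for l j
  proof -
    have "combination ?n zs (\<lambda>j. if j \<le> k then l j * ?h else 0) = (\<Sum>j\<le>k. (l j * ?h) \<cdot> zs ! j)"
      unfolding combination_def using k by (intro sum.mono_neutral_cong_right) auto
    also have "\<dots> = (\<Sum>j\<le>k. \<Sum>i<k. (l j * a j i) \<cdot> w i)"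
    proof (rule sum.cong[OF refl])
      fix j show "(l j * ?h) \<cdot> zs ! j = (\<Sum>i<k. (l j * a j i) \<cdot> w i)"
      proof -
        have "(l j * ?h) \<cdot> zs ! j = l j \<cdot> (\<Sum>i<k. a j i \<cdot> w i)"
          unfolding act_mult[of "l j" ?h] by (simp only: a)
        then show ?thesis by (simp only: act_sum_right act_mult)
      qed
    qed
    also have "\<dots> = (\<Sum>i<k. (\<Sum>j\<le>k. l j * a j i) \<cdot> w i)"
      by (subst sum.swap) (simp add: act_sum_left)
    also have "\<dots> = 0" using l by (simp add: rel_def)
    finally have all: "\<forall>i<?n. ps ! i dvd (if i \<le> k then l i * ?h else 0)" unfolding zero .
    have "ps ! j dvd l j * ?h" using all[rule_format, of j] j k by simp
    then show ?thesis using chain'[OF j k] dvd_trans by blast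
  qed
  \<comment> \<open>The generator of the ideal of all \<open>f\<close> with \<open>?p dvd f * ?h\<close>; it is a common divisor of the
    coefficients of every relation.\<close>
  obtain r where r: "lead_coeff r = 1" "\<And>f. ?p dvd f * ?h \<longleftrightarrow> r dvd f"
  proof (rule poly_ideal_principal[of "{f. ?p dvd f * ?h}" ?p])
    fix g assume "lead_coeff g = 1" "\<And>f. f \<in> {f. ?p dvd f * ?h} \<longleftrightarrow> g dvd f"
    then show thesis using that by auto
  qed (use nz in \<open>auto simp: distrib_right mult.assoc\<close>)
  have "degree r \<noteq> 0"
  proof
    assume "degree r = 0"
    with r(1) have "r = 1" by (rule monic_degree_0)
    then show False using r(2)[of 1] ndvd by simp
  qed
  have r0: "r \<noteq> 0" using r by auto
  obtain l0 where "rel l0" using polynomial_relation[of k a] by (auto simp: rel_def)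
  then obtain l where l: "rel l"
    and min: "\<And>l'. rel l' \<Longrightarrow> (\<Sum>j\<le>k. degree (l j)) \<le> (\<Sum>j\<le>k. degree (l' j))"
    using ex_has_least_nat[of rel l0 "\<lambda>l. \<Sum>j\<le>k. degree (l j)"] by blast
  define l' where "l' j = l j div r" for j
  have l': "l j = r * l' j" if "j \<le> k" for j
    using kills[OF l that] r by (simp add: l'_def)
  have eq: "r * (\<Sum>j\<le>k. l' j * a j i) = (\<Sum>j\<le>k. l j * a j i)" for i
    unfolding sum_distrib_left by (rule sum.cong) (simp_all add: l' mult.assoc)
  have "(\<Sum>j\<le>k. l' j * a j i) = 0" if "i < k" for i
  proof -
    have "r * (\<Sum>j\<le>k. l' j * a j i) = 0" unfolding eq using l that by (simp add: rel_def)
    then show ?thesis using r0 by (simp only: mult_eq_0_iff simp_thms)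
  qed
  moreover obtain j0 where j0: "j0 \<le> k" "l j0 \<noteq> 0" using l by (auto simp: rel_def)
  ultimately have "rel l'" using l'[of j0] by (auto simp: rel_def)
  moreover have "(\<Sum>j\<le>k. degree (l' j)) < (\<Sum>j\<le>k. degree (l j))"
  proof (rule sum_strict_mono_ex1)
    show "\<forall>j\<in>{..k}. degree (l' j) \<le> degree (l j)"
    proof
      fix j assume "j \<in> {..k}"
      then show "degree (l' j) \<le> degree (l j)"
        using l'[of j] r0 by (cases "l' j = 0") (auto simp: degree_mult_eq)
    qed
    show "\<exists>j\<in>{..k}. degree (l' j) < degree (l j)"
      using l'[of j0] j0 r0 \<open>degree r \<noteq> 0\<close> by (intro bexI[of _ j0]) (auto simp: degree_mult_eq)
  qed simp
  ultimately show False using min leD by blast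
qed

end

context linear_operator
begin

section \<open>Vectors of maximal order\<close>

definition submodule :: "'v set \<Rightarrow> bool" where
  "submodule W \<longleftrightarrow> 0 \<in> W \<and> (\<forall>x\<in>W. \<forall>y\<in>W. x + y \<in> W) \<and> (\<forall>p. \<forall>x\<in>W. p \<cdot> x \<in> W)"

lemma submodule_add: "submodule W \<Longrightarrow> x \<in> W \<Longrightarrow> y \<in> W \<Longrightarrow> x + y \<in> W"
  and submodule_act: "submodule W \<Longrightarrow> x \<in> W \<Longrightarrow> p \<cdot> x \<in> W"
  and submodule_zero: "submodule W \<Longrightarrow> 0 \<in> W"
  by (auto simp: submodule_def)

lemma submodule_diff: "submodule W \<Longrightarrow> x \<in> W \<Longrightarrow> y \<in> W \<Longrightarrow> x - y \<in> W"
  using submodule_add[of W x "(- 1) \<cdot> y"] submodule_act[of W y "- 1"]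
  by (simp add: act_uminus_left)

lemma submodule_subspace: "submodule W \<Longrightarrow> subspace W"
  unfolding subspace_def using submodule_act[of W _ "[:_:]"] by (auto simp: submodule_def)

lemma annihilating_poly:
  obtains p where "p \<noteq> 0" "degree p \<le> dimension" "p \<cdot> x = 0"
proof (cases "inj_on (\<lambda>i. (u ^^ i) x) {..dimension}")
  case True
  let ?S = "(\<lambda>i. (u ^^ i) x) ` {..dimension}"
  have "card ?S = Suc dimension" using True by (simp add: card_image)
  then have "dependent ?S"
    using independent_bound_general[of ?S] dim_subset_UNIV[of ?S] by auto
  then obtain c where c: "\<exists>y\<in>?S. c y \<noteq> 0" "(\<Sum>y\<in>?S. scale (c y) y) = 0"
    using dependent_finite[of ?S] by auto
  define p where "p = (\<Sum>i\<le>dimension. monom (c ((u ^^ i) x)) i)"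
  have "p \<cdot> x = (\<Sum>i\<le>dimension. scale (c ((u ^^ i) x)) ((u ^^ i) x))"
    unfolding p_def act_sum_left
    by (simp only: act_monom)
  also have "\<dots> = 0" using c(2) True by (simp add: sum.reindex)
  finally have "p \<cdot> x = 0" .
  moreover obtain j where j: "j \<le> dimension" "c ((u ^^ j) x) \<noteq> 0" using c(1) by auto
  have "coeff p j = c ((u ^^ j) x)" using j by (simp add: p_def coeff_sum)
  then have "p \<noteq> 0" using j by auto
  moreover have "degree p \<le> dimension"
    unfolding p_def by (rule degree_sum_le) (auto intro: order_trans[OF degree_monom_le])
  ultimately show thesis by (rule that[rotated 2])
next
  case False
  then obtain i j where ij: "i \<le> dimension" "j \<le> dimension" "i \<noteq> j" "(u ^^ i) x = (u ^^ j) x"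
    by (auto simp: inj_on_def)
  let ?p = "monom 1 i - monom 1 j :: 'a poly"
  have "coeff ?p i = 1" using ij(3) by simp
  then have "?p \<noteq> 0" by (metis coeff_0 zero_neq_one)
  moreover have "degree ?p \<le> dimension"
    using ij by (intro degree_diff_le order_trans[OF degree_monom_le])
  moreover have "?p \<cdot> x = 0" using ij by (simp add: act_diff_left act_monom)
  ultimately show thesis by (rule that)
qed

lemma order_polynomial:
  obtains m where "lead_coeff m = 1" "\<And>f. f \<cdot> x = 0 \<longleftrightarrow> m dvd f"
proof -
  obtain p where p: "p \<noteq> 0" "p \<cdot> x = 0" by (rule annihilating_poly)
  show thesis
  proof (rule poly_ideal_principal[of "{f. f \<cdot> x = 0}" p])
    fix g assume "lead_coeff g = 1" "\<And>f. f \<in> {f. f \<cdot> x = 0} \<longleftrightarrow> g dvd f"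
    then show thesis using that[of g] by auto
  qed (use p in \<open>auto simp: act_add_left act_mult\<close>)
qed

text \<open>Let \<open>p\<close> be the order of \<open>x\<close> and suppose that it does not kill \<open>y\<close>. Some irreducible \<open>\<pi>\<close> then
  occurs in the order of \<open>y\<close> with a larger multiplicity than its multiplicity \<open>n\<close> in \<open>p\<close>. With
  \<open>p = \<pi>\<^sup>n q\<close>, the vector \<open>\<pi>\<^sup>n \<cdot> x\<close> has order \<open>q\<close>, and a multiple of \<open>y\<close> has order \<open>\<pi>\<^sup>n\<^sup>+\<^sup>1\<close>. The two
  orders are coprime, so the sum of the two vectors has order \<open>q \<pi>\<^sup>n\<^sup>+\<^sup>1\<close>.\<close>
lemma larger_order:
  assumes W: "submodule W" "x \<in> W" "y \<in> W"
    and p: "\<And>f. f \<cdot> x = 0 \<longleftrightarrow> p dvd f" "p \<noteq> 0" and py: "p \<cdot> y \<noteq> 0"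
  obtains z where "z \<in> W" "\<And>f. f \<cdot> z = 0 \<Longrightarrow> f \<noteq> 0 \<Longrightarrow> degree p < degree f"
proof -
  obtain r where r: "lead_coeff r = 1" "\<And>f. f \<cdot> p \<cdot> y = 0 \<longleftrightarrow> r dvd f"
    using order_polynomial by metis
  have r0: "r \<noteq> 0" using r by auto
  have "degree r \<noteq> 0"
    using r monic_degree_0[of r] py by (metis act_1 one_dvd)
  then obtain \<pi> where \<pi>: "\<pi> dvd r" "degree \<pi> > 0"
    and min: "\<And>h. h dvd r \<Longrightarrow> degree h > 0 \<Longrightarrow> degree \<pi> \<le> degree h"
    using ex_has_least_nat[of "\<lambda>h. h dvd r \<and> degree h > 0" r degree] by auto
  obtain r' where r': "r = \<pi> * r'" using \<pi>(1) by auto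
  obtain n q where q: "p = \<pi> ^ n * q" "\<not> \<pi> dvd q"
    using factor_out_power[OF p(2) \<pi>(2)] .
  have \<pi>0: "\<pi> \<noteq> 0" using \<pi> by auto
  define y2 where "y2 = q \<cdot> r' \<cdot> y"
  have y2: "f \<cdot> \<pi> ^ n \<cdot> y2 = 0 \<longleftrightarrow> r dvd f * r'" for f
  proof -
    have "f \<cdot> \<pi> ^ n \<cdot> y2 = (f * r') \<cdot> p \<cdot> y"
      unfolding y2_def q(1) by (simp only: act_mult[symmetric] ac_simps)
    then show ?thesis by (simp add: r(2))
  qed
  have top: "\<pi> ^ Suc n \<cdot> y2 = 0"
    using y2[of \<pi>] by (simp add: act_mult r')
  have ntop: "\<pi> ^ n \<cdot> y2 \<noteq> 0"
  proof
    assume "\<pi> ^ n \<cdot> y2 = 0"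
    then have "r dvd r'" using y2[of 1] by simp
    then have "degree r \<le> degree r'" using r0 r' by (intro dvd_imp_degree_le) auto
    then show False using r' r0 \<pi>(2) by (auto simp: degree_mult_eq)
  qed
  define z where "z = \<pi> ^ n \<cdot> x + y2"
  have "z \<in> W" using W unfolding z_def y2_def by (intro submodule_add submodule_act)
  moreover have "degree p < degree f" if f: "f \<cdot> z = 0" "f \<noteq> 0" for f
  proof -
    have fz: "f \<cdot> \<pi> ^ n \<cdot> x + f \<cdot> y2 = 0" using f(1) by (simp add: z_def act_add_right)
    have "(\<pi> ^ Suc n * f * \<pi> ^ n) \<cdot> x = \<pi> ^ Suc n \<cdot> (f \<cdot> \<pi> ^ n \<cdot> x + f \<cdot> y2) - f \<cdot> \<pi> ^ Suc n \<cdot> y2"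
      unfolding act_add_right act_commute[of f "\<pi> ^ Suc n"] by (simp add: act_mult)
    also have "\<dots> = 0" by (simp only: fz top act_zero_right diff_self)
    finally have "p dvd \<pi> ^ n * (\<pi> ^ Suc n * f)" by (simp add: p(1) mult.commute mult.left_commute)
    then have "q dvd \<pi> ^ Suc n * f"
      unfolding q(1) using \<pi>0 by (simp add: dvd_mult_cancel_left del: power_Suc)
    moreover obtain s t where st: "s * q + t * \<pi> ^ Suc n = 1"
      using minimal_divisor_coprime[OF \<pi> min q(2)] by blast
    ultimately have "q dvd s * q * f + t * (\<pi> ^ Suc n * f)"
      by (intro dvd_add dvd_mult2[OF dvd_triv_right] dvd_mult[of _ "\<pi> ^ Suc n * f"])
    also have "s * q * f + t * (\<pi> ^ Suc n * f) = (s * q + t * \<pi> ^ Suc n) * f"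
      by (simp only: distrib_right mult.assoc)
    finally have "q dvd f" using st by simp
    then obtain f' where f': "f = q * f'" by auto
    have "f \<cdot> \<pi> ^ n \<cdot> x = 0"
      using p(1)[of "f * \<pi> ^ n"] unfolding f' q(1) by (simp add: act_mult[symmetric] mult.commute mult.left_commute)
    then have fy2: "f \<cdot> y2 = 0" using fz by simp
    have "f' \<noteq> 0" using f' f(2) by auto
    then obtain k g where g: "f' = \<pi> ^ k * g" "\<not> \<pi> dvd g"
      using factor_out_power[OF _ \<pi>(2)] by metis
    \<comment> \<open>If \<open>k \<le> n\<close>, a Bezout identity for the cofactor \<open>q * g\<close> gives \<open>\<pi> ^ k \<cdot> y2 = 0\<close>, against
      \<open>ntop\<close>.\<close>
    have "\<not> k < Suc n"
    proof
      assume "k < Suc n"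
      have "\<not> \<pi> dvd q * g"
      proof
        assume "\<pi> dvd q * g"
        obtain s t where st: "s * q + t * \<pi> ^ 1 = 1"
          using minimal_divisor_coprime[OF \<pi> min q(2)] by blast
        have "\<pi> dvd s * (q * g) + t * \<pi> * g" using \<open>\<pi> dvd q * g\<close> by (simp add: dvd_add)
        also have "s * (q * g) + t * \<pi> * g = (s * q + t * \<pi> ^ 1) * g"
          by (simp add: algebra_simps)
        finally show False using st g(2) by simp
      qed
      then obtain s t where st: "s * (q * g) + t * \<pi> ^ Suc n = 1"
        using minimal_divisor_coprime[OF \<pi> min] by blast
      have "\<pi> ^ k \<cdot> y2 = (s * (q * g) + t * \<pi> ^ Suc n) \<cdot> \<pi> ^ k \<cdot> y2" by (simp only: st act_1)
      also have "\<dots> = s \<cdot> f \<cdot> y2 + (t * \<pi> ^ k) \<cdot> \<pi> ^ Suc n \<cdot> y2"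
        unfolding act_add_left f' g(1) by (simp only: act_mult[symmetric] ac_simps)
      also have "\<dots> = 0" by (simp only: fy2 top act_zero_right add_0)
      finally have "\<pi> ^ (n - k) \<cdot> \<pi> ^ k \<cdot> y2 = 0" by simp
      then have "\<pi> ^ n \<cdot> y2 = 0"
        using \<open>k < Suc n\<close> by (simp add: act_mult[symmetric] power_add[symmetric])
      then show False using ntop by simp
    qed
    have nz: "q \<noteq> 0" "g \<noteq> 0" using f' f(2) g by auto
    have "degree p = n * degree \<pi> + degree q"
      unfolding q(1) using nz \<pi>0 by (simp add: degree_mult_eq degree_power_eq)
    also have "\<dots> < k * degree \<pi> + degree q"
      using \<open>\<not> k < Suc n\<close> \<pi>(2) by simp
    also have "\<dots> \<le> degree f"
      unfolding f' g(1) using nz \<pi>0 by (simp add: degree_mult_eq degree_power_eq)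
    finally show ?thesis .
  qed
  ultimately show thesis by (rule that)
qed

text \<open>A vector whose order has the largest degree is killed only by polynomials that kill all of
  \<open>W\<close>; degrees of orders are bounded by the dimension.\<close>
lemma maximal_vector:
  assumes W: "submodule W"
  obtains x m where "x \<in> W" "lead_coeff m = 1" "\<And>f. f \<cdot> x = 0 \<longleftrightarrow> m dvd f"
    "\<And>w. w \<in> W \<Longrightarrow> m \<cdot> w = 0"
proof -
  define P where "P d \<longleftrightarrow> (\<exists>x\<in>W. \<exists>m. lead_coeff m = 1 \<and> (\<forall>f. f \<cdot> x = 0 \<longleftrightarrow> m dvd f) \<and> degree m = d)" for d
  have bound: "d \<le> dimension" if "P d" for d
  proof -
    from that obtain x m where m: "\<And>f. f \<cdot> x = 0 \<longleftrightarrow> m dvd f" "degree m = d"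
      by (auto simp: P_def)
    obtain p where p: "p \<noteq> 0" "degree p \<le> dimension" "p \<cdot> x = 0" by (rule annihilating_poly)
    then show ?thesis using m dvd_imp_degree_le[of m p] by auto
  qed
  obtain m0 where "lead_coeff m0 = 1" "\<And>f. f \<cdot> 0 = 0 \<longleftrightarrow> m0 dvd f"
    using order_polynomial by metis
  then have ex: "P (degree m0)"
    unfolding P_def using submodule_zero[OF W] by (intro bexI[of _ 0] exI[of _ m0]) auto
  define d where "d = Greatest P"
  have "P d" and max: "\<And>e. P e \<Longrightarrow> e \<le> d"
    unfolding d_def using GreatestI_nat[of P, OF ex] Greatest_le_nat[of P] bound by auto
  then obtain x m where x: "x \<in> W" "lead_coeff m = 1" "\<And>f. f \<cdot> x = 0 \<longleftrightarrow> m dvd f" "degree m = d"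
    by (auto simp: P_def)
  have "m \<cdot> w = 0" if w: "w \<in> W" for w
  proof (rule ccontr)
    assume "m \<cdot> w \<noteq> 0"
    moreover have "m \<noteq> 0" using x by auto
    ultimately obtain z where z: "z \<in> W" "\<And>f. f \<cdot> z = 0 \<Longrightarrow> f \<noteq> 0 \<Longrightarrow> d < degree f"
      using larger_order[OF W x(1) w x(3)] x(4) by metis
    obtain m' where m': "lead_coeff m' = 1" "\<And>f. f \<cdot> z = 0 \<longleftrightarrow> m' dvd f"
      using order_polynomial by metis
    then have "P (degree m')" using z(1) by (auto simp: P_def)
    then have "degree m' \<le> d" by (rule max)
    moreover have "m' \<noteq> 0" using m' by auto
    then have "d < degree m'" using z(2)[of m'] m'(2)[of m'] by simp
    ultimately show False by simp
  qed
  then show thesis using that x by blast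
qed

section \<open>Decompositions exchanged by the operator\<close>

text \<open>A \<open>\<int>/2\<close>-grading for which \<open>u\<close> is odd, up to the directness of the sum, which will follow
  from the behaviour of a nondegenerate form on \<open>M\<close> and \<open>N\<close>.\<close>
definition swapped_sum :: "'v set \<Rightarrow> 'v set \<Rightarrow> 'v set \<Rightarrow> bool" where
  "swapped_sum W M N \<longleftrightarrow> subspace M \<and> subspace N \<and> u ` M \<subseteq> N \<and> u ` N \<subseteq> M \<and>
     W = {m + n | m n. m \<in> M \<and> n \<in> N}"

lemma swapped_sum_add:
  assumes "swapped_sum V M N" "swapped_sum W M' N'"
  shows "swapped_sum {v + w | v w. v \<in> V \<and> w \<in> W}
    {m + m' | m m'. m \<in> M \<and> m' \<in> M'} {n + n' | n n'. n \<in> N \<and> n' \<in> N'}"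
proof -
  have "{v + w | v w. v \<in> V \<and> w \<in> W}
    = {a + c | a c. a \<in> {m + m' | m m'. m \<in> M \<and> m' \<in> M'} \<and> c \<in> {n + n' | n n'. n \<in> N \<and> n' \<in> N'}}"
    (is "?L = ?R")
  proof (intro equalityI subsetI)
    fix x assume "x \<in> ?L"
    then obtain m n m' n' where *: "m \<in> M" "n \<in> N" "m' \<in> M'" "n' \<in> N'" "x = (m + n) + (m' + n')"
      using assms unfolding swapped_sum_def by blast
    then have "x = (m + m') + (n + n')" by (simp add: ac_simps)
    then show "x \<in> ?R" using * by blast
  next
    fix x assume "x \<in> ?R"
    then obtain m n m' n' where *: "m \<in> M" "n \<in> N" "m' \<in> M'" "n' \<in> N'" "x = (m + m') + (n + n')"
      by blast
    then have "x = (m + n) + (m' + n')" by (simp add: ac_simps)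
    then show "x \<in> ?L" using * assms unfolding swapped_sum_def by blast
  qed
  moreover have "u ` {m + m' | m m'. m \<in> M \<and> m' \<in> M'} \<subseteq> {n + n' | n n'. n \<in> N \<and> n' \<in> N'}"
    if "u ` M \<subseteq> N" "u ` M' \<subseteq> N'" for M N M' N'
    using that by (fastforce simp: u.add)
  ultimately show ?thesis
    using assms unfolding swapped_sum_def by (simp add: subspace_sums)
qed

text \<open>Only the parities of \<open>i\<close> and \<open>j\<close> matter; their difference is a shift between the gradings of
  the two generators, which can be chosen freely.\<close>
definition graded :: "'v \<Rightarrow> 'v \<Rightarrow> nat \<Rightarrow> nat \<Rightarrow> 'v set" where
  "graded x y i j = {f \<cdot> x + g \<cdot> y | f g. parity_poly i f \<and> parity_poly j g}"

lemma subspace_graded: "subspace (graded x y i j)"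
proof (rule subspaceI)
  show "0 \<in> graded x y i j"
    unfolding graded_def by (rule CollectI, rule exI[of _ 0], rule exI[of _ 0]) simp
next
  fix v w assume "v \<in> graded x y i j" "w \<in> graded x y i j"
  then obtain f g f' g' where *: "parity_poly i f" "parity_poly j g" "parity_poly i f'" "parity_poly j g'"
    "v = f \<cdot> x + g \<cdot> y" "w = f' \<cdot> x + g' \<cdot> y" by (auto simp: graded_def)
  then have "v + w = (f + f') \<cdot> x + (g + g') \<cdot> y" by (simp add: act_add_left ac_simps)
  then show "v + w \<in> graded x y i j"
    unfolding graded_def using * parity_poly_add by blast
next
  fix c v assume "v \<in> graded x y i j"
  then obtain f g where *: "parity_poly i f" "parity_poly j g" "v = f \<cdot> x + g \<cdot> y"
    by (auto simp: graded_def)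
  then have "scale c v = smult c f \<cdot> x + smult c g \<cdot> y" by (simp add: act_smult scale_right_distrib)
  moreover have "parity_poly i (smult c f)" "parity_poly j (smult c g)"
    using * by (auto simp: parity_poly_def)
  ultimately show "scale c v \<in> graded x y i j" unfolding graded_def by blast
qed

lemma u_graded: "u ` graded x y i j \<subseteq> graded x y (Suc i) (Suc j)"
proof
  fix w assume "w \<in> u ` graded x y i j"
  then obtain f g where *: "parity_poly i f" "parity_poly j g" "w = u (f \<cdot> x + g \<cdot> y)"
    by (auto simp: graded_def)
  have "w = (monom 1 1 * f) \<cdot> x + (monom 1 1 * g) \<cdot> y"
    by (simp add: * act_mult act_monom u.add)
  moreover have "parity_poly 1 (monom 1 1 :: 'a poly)" by (rule parity_poly_monom) simp
  then have "parity_poly (1 + i) (monom 1 1 * f)" "parity_poly (1 + j) (monom 1 1 * g)"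
    using * parity_poly_mult by blast+
  ultimately show "w \<in> graded x y (Suc i) (Suc j)"
    unfolding graded_def plus_1_eq_Suc by blast
qed

lemma graded_cong: "even (i + i') \<Longrightarrow> even (j + j') \<Longrightarrow> graded x y i j = graded x y i' j'"
  by (simp add: graded_def parity_poly_cong[of i i'] parity_poly_cong[of j j'])

lemma swapped_sum_graded:
  "swapped_sum {f \<cdot> x + g \<cdot> y | f g. True} (graded x y 0 j) (graded x y 1 (Suc j))"
proof -
  have "{f \<cdot> x + g \<cdot> y | f g. True}
    = {m + n | m n. m \<in> graded x y 0 j \<and> n \<in> graded x y 1 (Suc j)}" (is "?L = ?R")
  proof (intro equalityI subsetI)
    fix v assume "v \<in> ?L"
    then obtain f g where v: "v = f \<cdot> x + g \<cdot> y" by blast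
    obtain f0 f1 where f: "f = f0 + f1" "parity_poly 0 f0" "parity_poly (Suc 0) f1"
      by (rule parity_parts)
    obtain g0 g1 where g: "g = g0 + g1" "parity_poly j g0" "parity_poly (Suc j) g1"
      by (rule parity_parts)
    have "v = (f0 \<cdot> x + g0 \<cdot> y) + (f1 \<cdot> x + g1 \<cdot> y)"
      by (simp add: v f(1) g(1) act_add_left ac_simps)
    moreover have "f0 \<cdot> x + g0 \<cdot> y \<in> graded x y 0 j" using f g unfolding graded_def by blast
    moreover have "f1 \<cdot> x + g1 \<cdot> y \<in> graded x y 1 (Suc j)"
      using f g unfolding graded_def One_nat_def by blast
    ultimately show "v \<in> ?R" by blast
  next
    fix v assume "v \<in> ?R"
    then obtain f g f' g' where "v = (f \<cdot> x + g \<cdot> y) + (f' \<cdot> x + g' \<cdot> y)"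
      by (auto simp: graded_def)
    then have "v = (f + f') \<cdot> x + (g + g') \<cdot> y" by (simp add: act_add_left ac_simps)
    then show "v \<in> ?L" by blast
  qed
  moreover have "u ` graded x y 1 (Suc j) \<subseteq> graded x y 0 j"
    using u_graded[of x y 1 "Suc j"] graded_cong[of "Suc 1" 0 "Suc (Suc j)" j x y] by simp
  ultimately show ?thesis
    unfolding swapped_sum_def using subspace_graded u_graded[of x y 0 j] by simp
qed

text \<open>Once the sum is direct, the projection onto \<open>M\<close> along \<open>N\<close> and its complement are exchanged
  by \<open>u\<close>.\<close>
lemma swapped_sum_projection:
  assumes sum: "swapped_sum UNIV M N" and int: "M \<inter> N \<subseteq> {0}"
  obtains \<pi> where "endomorphism scale \<pi>" "\<forall>z. \<pi> z \<in> M" "\<forall>z. z - \<pi> z \<in> N"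
    "\<forall>z\<in>M. \<pi> z = z" "\<forall>z\<in>N. \<pi> z = 0" "\<forall>z. \<pi> (u z) = u (z - \<pi> z)"
proof -
  have M: "subspace M" and N: "subspace N" using sum by (auto simp: swapped_sum_def)
  have "\<exists>m. m \<in> M \<and> z - m \<in> N" for z
  proof -
    obtain m n where "m \<in> M" "n \<in> N" "z = m + n"
      using sum unfolding swapped_sum_def by blast
    then show ?thesis by (intro exI[of _ m]) simp
  qed
  then obtain \<pi> where \<pi>: "\<And>z. \<pi> z \<in> M" "\<And>z. z - \<pi> z \<in> N" by metis
  have uniq: "\<pi> z = m" if "m \<in> M" "z - m \<in> N" for z m
  proof -
    have "\<pi> z - m \<in> M" using subspace_diff[OF M \<pi>(1) that(1)] .
    moreover have "\<pi> z - m = (z - m) - (z - \<pi> z)" by simp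
    then have "\<pi> z - m \<in> N" using subspace_diff[OF N that(2) \<pi>(2)] by metis
    ultimately have "\<pi> z - m = 0" using int by blast
    then show ?thesis by simp
  qed
  have "\<pi> (y + z) = \<pi> y + \<pi> z" for y z
  proof (rule uniq)
    show "\<pi> y + \<pi> z \<in> M" using M \<pi>(1) by (simp add: subspace_add)
    show "y + z - (\<pi> y + \<pi> z) \<in> N"
      using subspace_add[OF N \<pi>(2)[of y] \<pi>(2)[of z]] by (simp add: algebra_simps)
  qed
  moreover have "\<pi> (scale c z) = scale c (\<pi> z)" for c z
  proof (rule uniq)
    show "scale c (\<pi> z) \<in> M" using M \<pi>(1) by (simp add: subspace_scale)
    show "scale c z - scale c (\<pi> z) \<in> N"
      using subspace_scale[OF N \<pi>(2)[of z], of c] by (simp add: scale_right_diff_distrib)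
  qed
  ultimately have "endomorphism scale \<pi>"
    unfolding endomorphism_def by unfold_locales
  moreover have "\<pi> (u z) = u (z - \<pi> z)" for z
  proof (rule uniq)
    show "u (z - \<pi> z) \<in> M" using sum \<pi>(2) by (auto simp: swapped_sum_def)
    have "u z - u (z - \<pi> z) = u (\<pi> z)" by (simp add: u.diff)
    then show "u z - u (z - \<pi> z) \<in> N" using sum \<pi>(1) by (auto simp: swapped_sum_def)
  qed
  moreover have "\<pi> z = z" if "z \<in> M" for z
    using that N by (intro uniq) (auto simp: subspace_0)
  moreover have "\<pi> z = 0" if "z \<in> N" for z
    using that M by (intro uniq) (auto simp: subspace_0)
  ultimately show thesis using \<pi> that by blast
qed

end

section \<open>Splitting off hyperbolic pairs\<close>

locale alternating_operator = linear_operator +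
  fixes b :: "'b \<Rightarrow> 'b \<Rightarrow> 'a"
  assumes symplectic: "symplectic_form scale b"
    and alternating_u: "b x (u x) = 0"
begin

lemma linear_b_right: "Vector_Spaces.linear scale (*) (b x)"
  and linear_b_left: "Vector_Spaces.linear scale (*) (\<lambda>x. b x y)"
  using symplectic by (auto simp: symplectic_form_def bilinear_form_def)

lemma b_add_right: "b x (y + z) = b x y + b x z"
  and b_add_left: "b (x + y) z = b x z + b y z"
  and b_scale_right: "b x (scale c y) = c * b x y"
  and b_scale_left: "b (scale c x) y = c * b x y"
  using Vector_Spaces.linear.axioms(3)[OF linear_b_right] Vector_Spaces.linear.axioms(3)[OF linear_b_left]
  by (auto simp: module_hom_def module_hom_axioms_def)

lemma b_self [simp]: "b x x = 0"
  using symplectic by (simp add: symplectic_form_def)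

lemma b_zero_right [simp]: "b x 0 = 0"
  and b_zero_left [simp]: "b 0 x = 0"
  using b_scale_right[of x 0 0] b_scale_left[of 0 0 x] by simp_all

lemma b_diff_right: "b x (y - z) = b x y - b x z"
  using b_add_right[of x "y - z" z] by (simp add: eq_diff_eq)

lemma b_diff_left: "b (x - y) z = b x z - b y z"
  using b_add_left[of "x - y" y z] by (simp add: eq_diff_eq)

lemma b_skew: "b y x = - b x y"
proof -
  have "0 = b (x + y) (x + y)" by simp
  also have "\<dots> = b x y + b y x" by (simp only: b_add_left b_add_right) simp
  finally show ?thesis by (metis add_eq_0_iff)
qed

lemma b_u: "b (u x) y = b x (u y)"
proof -
  have "0 = b (x + y) (u (x + y))" by (simp only: alternating_u)
  also have "\<dots> = b x (u y) + b y (u x)"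
    by (simp only: u.add b_add_left b_add_right alternating_u) simp
  finally show ?thesis by (metis b_skew add_eq_0_iff2)
qed

lemma b_act: "b (p \<cdot> x) y = b x (p \<cdot> y)"
  by (induction p arbitrary: x y)
    (simp_all add: act_pCons b_add_left b_add_right b_scale_left b_scale_right b_u act_u)

text \<open>A cyclic submodule is totally isotropic: up to moving powers of \<open>u\<close> across the form,
  \<open>b x (u\<^sup>n x)\<close> is \<open>b z z\<close> or \<open>b z (u z)\<close>, where \<open>z\<close> is the power of \<open>u\<close> with exponent \<open>n div 2\<close> applied
  to \<open>x\<close>. Both vanish, in characteristic 2 as well, because the form and the operator are alternating
  and not merely skew and selfadjoint.\<close>
lemma b_act_self: "b (f \<cdot> x) (g \<cdot> x) = 0"
proof -
  have pow: "b x ((u ^^ n) x) = 0" for n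
  proof -
    have split: "b x (monom 1 (i + j) \<cdot> x) = b ((u ^^ i) x) ((u ^^ j) x)" for i j
      by (simp only: act_monom[of 1, simplified, symmetric] b_act act_mult[symmetric] mult_monom mult_1)
    obtain k where "n = k + k \<or> n = k + Suc k"
      using oddE[of n] evenE[of n] by (metis Suc_eq_plus1 add_Suc_right mult_2)
    then show ?thesis
      using split[of k k] split[of k "Suc k"] alternating_u[of "(u ^^ k) x"] by (auto simp: act_monom)
  qed
  have "b x (h \<cdot> x) = 0" for h
  proof -
    have sum: "b x (\<Sum>i\<in>I. F i) = (\<Sum>i\<in>I. b x (F i))" for F :: "nat \<Rightarrow> 'b" and I
      by (induction I rule: infinite_finite_induct) (simp_all add: b_add_right)
    show ?thesis by (simp add: poly_action_def sum b_scale_right pow)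
  qed
  then show ?thesis by (metis b_act act_mult)
qed

definition nondegenerate_on :: "'b set \<Rightarrow> bool" where
  "nondegenerate_on W \<longleftrightarrow> (\<forall>x\<in>W. (\<forall>y\<in>W. b x y = 0) \<longrightarrow> x = 0)"

text \<open>Take \<open>x\<close> of maximal order \<open>m\<close>. Every functional \<open>f \<mapsto> b (f \<cdot> x) y\<close> is
  \<open>f \<mapsto> top_residue m (f * g)\<close> for some \<open>g\<close>, and the polynomials \<open>g\<close> that arise from some \<open>y\<close> form an
  ideal. A proper ideal would have a generator \<open>g\<close> with \<open>m = g * h\<close>, and then \<open>h \<cdot> x\<close> would be
  orthogonal to all of \<open>W\<close>, although \<open>m\<close> does not divide \<open>h\<close>. Hence \<open>g = 1\<close> is attained by some \<open>y\<close>.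
  The cyclic modules of \<open>x\<close> and \<open>y\<close> are totally isotropic and perfectly paired, so their sum has an
  orthogonal complement in \<open>W\<close>.\<close>
lemma split_hyperbolic_pair:
  assumes W: "submodule W" and nd: "nondegenerate_on W" and ne: "W \<noteq> {0}"
  obtains m x y W' where "x \<in> W" "lead_coeff m = 1" "degree m > 0"
    "\<forall>w\<in>W. m \<cdot> w = 0" "\<forall>f. f \<cdot> x = 0 \<longrightarrow> m dvd f"
    "\<forall>f g. b (f \<cdot> x) (g \<cdot> y) = top_residue m (f * g)"
    "submodule W'" "nondegenerate_on W'" "x \<notin> W'" "y \<in> W"
    "\<forall>f. \<forall>w\<in>W'. b (f \<cdot> x) w = 0" "\<forall>f. \<forall>w\<in>W'. b (f \<cdot> y) w = 0"
    "W = {f \<cdot> x + (g \<cdot> y + w) | f g w. w \<in> W'}"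
proof -
  obtain x m where x: "x \<in> W" and lc: "lead_coeff m = 1"
    and ord: "\<And>f. f \<cdot> x = 0 \<longleftrightarrow> m dvd f" and kill: "\<And>w. w \<in> W \<Longrightarrow> m \<cdot> w = 0"
    using maximal_vector[OF W] by blast
  have deg: "degree m > 0"
  proof (rule ccontr)
    assume "\<not> degree m > 0"
    then have "degree m = 0" by simp
    with lc have "m = 1" by (rule monic_degree_0)
    then have "W \<subseteq> {0}" using kill by auto
    then show False using ne submodule_zero[OF W] by blast
  qed
  have represent: "\<exists>g. \<forall>f. b (f \<cdot> v) w = top_residue m (f * g)" if v: "v \<in> W" for v w
  proof (rule top_residue_represents[OF deg])
    show "b ((m * f) \<cdot> v) w = 0" for f
      using kill[OF submodule_act[OF W v]] by (simp add: act_mult)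
  qed (auto simp: act_add_left b_add_left act_smult b_scale_left)
  define I where "I = {g. \<exists>y\<in>W. \<forall>f. b (f \<cdot> x) y = top_residue m (f * g)}"
  have "1 \<in> I"
  proof (rule poly_ideal_principal[of I m])
    fix f g assume "f \<in> I" "g \<in> I"
    then obtain y z where "y \<in> W" "z \<in> W" "\<And>h. b (h \<cdot> x) y = top_residue m (h * f)"
      "\<And>h. b (h \<cdot> x) z = top_residue m (h * g)" by (auto simp: I_def)
    then show "f + g \<in> I"
      unfolding I_def using submodule_add[OF W, of y z]
      by (auto intro!: bexI[of _ "y + z"] simp: b_add_right distrib_left top_residue_add)
  next
    fix f g assume "f \<in> I"
    then obtain y where y: "y \<in> W" "\<And>h. b (h \<cdot> x) y = top_residue m (h * f)"
      by (auto simp: I_def)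
    have "b (h \<cdot> x) (g \<cdot> y) = top_residue m (h * (g * f))" for h
      using y(2)[of "h * g"] by (metis act_mult b_act mult.assoc mult.commute)
    then show "g * f \<in> I" unfolding I_def using submodule_act[OF W y(1)] by blast
  next
    show "m \<in> I"
      unfolding I_def using submodule_zero[OF W] by (auto intro!: bexI[of _ 0] simp: top_residue_dvd)
    show "m \<noteq> 0" using lc by auto
  next
    fix g assume "g \<in> I" and g: "\<And>f. f \<in> I \<longleftrightarrow> g dvd f"
    have "m \<in> I"
      unfolding I_def using submodule_zero[OF W] by (auto intro!: bexI[of _ 0] simp: top_residue_dvd)
    then obtain h where h: "m = g * h" using g by auto
    have "b (h \<cdot> x) y = 0" if "y \<in> W" for y
    proof -
      obtain k where k: "\<And>f. b (f \<cdot> x) y = top_residue m (f * k)" using represent[OF x] by blast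
      then have "k \<in> I" using that by (auto simp: I_def)
      then have "m dvd h * k" unfolding h using g by (simp add: mult.commute mult_dvd_mono)
      then show ?thesis by (simp add: k top_residue_dvd)
    qed
    then have "h \<cdot> x = 0"
      using nd submodule_act[OF W x] by (auto simp: nondegenerate_on_def)
    then obtain c where "h = m * c" using ord by auto
    then have "m * (g * c) = m * 1" using h by (simp add: ac_simps)
    then have "g * c = 1" using lc by (subst (asm) mult_cancel_left) auto
    then show "1 \<in> I" using g by (metis dvd_triv_left)
  qed
  then obtain y where y: "y \<in> W" "\<And>f. b (f \<cdot> x) y = top_residue m f"
    by (auto simp: I_def)
  have xy: "b (f \<cdot> x) (g \<cdot> y) = top_residue m (f * g)" for f g
    using y(2)[of "f * g"] by (metis act_mult b_act mult.commute)
  have yx: "b (f \<cdot> y) (g \<cdot> x) = top_residue m (f * (- g))" for f g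
  proof -
    have "top_residue m (f * (- g)) = b ((- g) \<cdot> x) (f \<cdot> y)" by (simp only: xy mult.commute)
    also have "\<dots> = - b (g \<cdot> x) (f \<cdot> y)"
      using b_diff_left[of 0 "g \<cdot> x" "f \<cdot> y"] by (simp add: act_uminus_left)
    finally show ?thesis using b_skew[of "f \<cdot> y" "g \<cdot> x"] by simp
  qed
  define W' where "W' = {w \<in> W. \<forall>f. b (f \<cdot> x) w = 0 \<and> b (f \<cdot> y) w = 0}"
  have sub: "submodule W'"
    unfolding submodule_def
  proof (intro conjI ballI allI)
    show "0 \<in> W'" using submodule_zero[OF W] by (simp add: W'_def)
    show "v + w \<in> W'" if "v \<in> W'" "w \<in> W'" for v w
      using that submodule_add[OF W] by (simp add: W'_def b_add_right)
    show "p \<cdot> w \<in> W'" if "w \<in> W'" for p w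
      using that submodule_act[OF W] by (simp add: W'_def b_act[of p, symmetric] act_mult[symmetric])
  qed
  have decomp: "W = {f \<cdot> x + (g \<cdot> y + w) | f g w. w \<in> W'}"
  proof (intro equalityI subsetI)
    fix w assume w: "w \<in> W"
    obtain g where g: "\<And>f. b (f \<cdot> x) w = top_residue m (f * g)" using represent[OF x] by blast
    obtain k where k: "\<And>f. b (f \<cdot> y) w = top_residue m (f * k)" using represent[OF y(1)] by blast
    \<comment> \<open>The pairing of \<open>y\<close> with \<open>x\<close> has the opposite sign, hence the coefficient \<open>- k\<close>.\<close>
    define w' where "w' = w - (- k) \<cdot> x - g \<cdot> y"
    have "w' \<in> W" unfolding w'_def using W x y(1) w by (intro submodule_diff submodule_act)
    moreover have "b (f \<cdot> x) w' = 0" "b (f \<cdot> y) w' = 0" for f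
      by (simp_all add: w'_def b_diff_right g xy k b_act_self yx)
    ultimately have "w' \<in> W'" by (simp add: W'_def)
    moreover have "w = (- k) \<cdot> x + (g \<cdot> y + w')" by (simp add: w'_def)
    ultimately show "w \<in> {f \<cdot> x + (g \<cdot> y + w) | f g w. w \<in> W'}" by blast
  next
    fix v assume "v \<in> {f \<cdot> x + (g \<cdot> y + w) | f g w. w \<in> W'}"
    then show "v \<in> W"
      using W x y(1) by (auto simp: W'_def intro!: submodule_add submodule_act)
  qed
  have nd': "nondegenerate_on W'"
    unfolding nondegenerate_on_def
  proof (intro ballI impI)
    fix w assume w: "w \<in> W'" "\<forall>w'\<in>W'. b w w' = 0"
    have "b w v = 0" if v: "v \<in> W" for v
    proof -
      obtain f g w' where "v = f \<cdot> x + (g \<cdot> y + w')" "w' \<in> W'" using v decomp by blast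
      then show ?thesis
        using w b_skew[of w "f \<cdot> x"] b_skew[of w "g \<cdot> y"] by (simp add: W'_def b_add_right)
    qed
    then show "w = 0" using nd w(1) by (simp add: nondegenerate_on_def W'_def)
  qed
  have xW': "x \<notin> W'"
  proof
    assume "x \<in> W'"
    then have "top_residue m (1 * h) = 0" for h
      using xy[of 1 h] b_skew[of x "h \<cdot> y"] by (simp add: W'_def)
    then have "m dvd 1" using top_residue_nondegenerate[OF deg] by blast
    then show False using deg by (metis dvd_imp_degree_le degree_1 leD zero_neq_one)
  qed
  show thesis
  proof (rule that[OF x lc deg _ _ _ sub nd' _ y(1) _ _ decomp])
  qed (use kill ord xy xW' in \<open>auto simp: W'_def\<close>)
qed

section \<open>Parity gradings and the symplectic decomposition\<close>

text \<open>Both pieces are Lagrangian subspaces when \<open>W\<close> is nondegenerate.\<close>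
definition isotropic_sum :: "'b set \<Rightarrow> bool" where
  "isotropic_sum W \<longleftrightarrow> (\<exists>M N. swapped_sum W M N \<and>
     (\<forall>x\<in>M. \<forall>y\<in>M. b x y = 0) \<and> (\<forall>x\<in>N. \<forall>y\<in>N. b x y = 0))"

definition orthogonal_sum :: "'b set \<Rightarrow> bool" where
  "orthogonal_sum W \<longleftrightarrow> (\<exists>M N. swapped_sum W M N \<and> (\<forall>x\<in>M. \<forall>y\<in>N. b x y = 0))"

lemma orthogonal_sums_vanish:
  assumes "swapped_sum V M N" "swapped_sum W M' N'"
    and orth: "\<forall>v\<in>V. \<forall>w\<in>W. b v w = 0"
    and A: "A \<subseteq> V" "A' \<subseteq> W" and C: "C \<subseteq> V" "C' \<subseteq> W"
    and "\<forall>x\<in>A. \<forall>y\<in>C. b x y = 0" "\<forall>x\<in>A'. \<forall>y\<in>C'. b x y = 0"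
    and x: "x \<in> {a + a' | a a'. a \<in> A \<and> a' \<in> A'}" and y: "y \<in> {c + c' | c c'. c \<in> C \<and> c' \<in> C'}"
  shows "b x y = 0"
proof -
  obtain a a' c c' where *: "a \<in> A" "a' \<in> A'" "c \<in> C" "c' \<in> C'" "x = a + a'" "y = c + c'"
    using x y by blast
  have "b a c' = 0" using orth A C * by blast
  moreover have "b a' c = 0" using orth A C * b_skew[of a' c] by auto
  ultimately show ?thesis using assms * by (simp add: b_add_left b_add_right)
qed

lemma swapped_sum_subset:
  assumes "swapped_sum W M N"
  shows "M \<subseteq> W" "N \<subseteq> W"
proof -
  have 0: "0 \<in> M" "0 \<in> N" and W: "W = {m + n | m n. m \<in> M \<and> n \<in> N}"
    using assms subspace_0 by (auto simp: swapped_sum_def)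
  show "M \<subseteq> W"
  proof
    fix m assume "m \<in> M"
    then have "m + 0 \<in> W" using 0 unfolding W by blast
    then show "m \<in> W" by simp
  qed
  show "N \<subseteq> W"
  proof
    fix n assume "n \<in> N"
    then have "0 + n \<in> W" using 0 unfolding W by blast
    then show "n \<in> W" by simp
  qed
qed

lemma isotropic_sum_add:
  assumes "isotropic_sum V" "isotropic_sum W"
    and orth: "\<forall>v\<in>V. \<forall>w\<in>W. b v w = 0"
  shows "isotropic_sum {v + w | v w. v \<in> V \<and> w \<in> W}"
proof -
  obtain M N M' N' where *: "swapped_sum V M N" "swapped_sum W M' N'"
    "\<forall>x\<in>M. \<forall>y\<in>M. b x y = 0" "\<forall>x\<in>N. \<forall>y\<in>N. b x y = 0"
    "\<forall>x\<in>M'. \<forall>y\<in>M'. b x y = 0" "\<forall>x\<in>N'. \<forall>y\<in>N'. b x y = 0"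
    using assms unfolding isotropic_sum_def by blast
  note sub = swapped_sum_subset[OF *(1)] swapped_sum_subset[OF *(2)]
  note van = orthogonal_sums_vanish[OF *(1,2) orth]
  show ?thesis
    unfolding isotropic_sum_def
    using swapped_sum_add[OF *(1,2)] van[OF sub(1,3,1,3) *(3,5)] van[OF sub(2,4,2,4) *(4,6)]
    by blast
qed

lemma orthogonal_sum_add:
  assumes "orthogonal_sum V" "orthogonal_sum W"
    and orth: "\<forall>v\<in>V. \<forall>w\<in>W. b v w = 0"
  shows "orthogonal_sum {v + w | v w. v \<in> V \<and> w \<in> W}"
proof -
  obtain M N M' N' where *: "swapped_sum V M N" "swapped_sum W M' N'"
    "\<forall>x\<in>M. \<forall>y\<in>N. b x y = 0" "\<forall>x\<in>M'. \<forall>y\<in>N'. b x y = 0"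
    using assms unfolding orthogonal_sum_def by blast
  note sub = swapped_sum_subset[OF *(1)] swapped_sum_subset[OF *(2)]
  show ?thesis
    unfolding orthogonal_sum_def
    using swapped_sum_add[OF *(1,2)] orthogonal_sums_vanish[OF *(1,2) orth sub(1,3,2,4) *(3,4)]
    by blast
qed

text \<open>Both cross terms are residues of polynomials that have the parity of the degree of \<open>m\<close>.\<close>
lemma graded_orthogonal:
  assumes par: "parity_poly (degree m) m" and deg: "degree m > 0"
    and xy: "\<And>f g. b (f \<cdot> x) (g \<cdot> y) = top_residue m (f * g)"
    and v: "v \<in> graded x y i j" and w: "w \<in> graded x y i' j'"
    and even: "even (i + j' + degree m)" "even (i' + j + degree m)"
  shows "b v w = 0"
proof -
  obtain f g where f: "v = f \<cdot> x + g \<cdot> y" "parity_poly i f" "parity_poly j g"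
    using v by (auto simp: graded_def)
  obtain f' g' where f': "w = f' \<cdot> x + g' \<cdot> y" "parity_poly i' f'" "parity_poly j' g'"
    using w by (auto simp: graded_def)
  have "top_residue m (f * g') = 0"
    using parity_poly_mult[OF f(2) f'(3)] parity_poly_cong[OF even(1)]
    by (intro top_residue_parity[OF par deg]) auto
  moreover have "top_residue m (f' * g) = 0"
    using parity_poly_mult[OF f'(2) f(3)] parity_poly_cong[OF even(2)]
    by (intro top_residue_parity[OF par deg]) auto
  ultimately show ?thesis
    using b_skew[of "g \<cdot> y" "f' \<cdot> x"]
    by (simp add: f(1) f'(1) b_add_left b_add_right b_act_self xy)
qed

text \<open>The shift between the gradings of the two generators decides which of the two patterns
  appears: a shift of the parity of \<open>degree m\<close> gives isotropic pieces, the other shift gives pieces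
  orthogonal to each other.\<close>
lemma hyperbolic_pair_sums:
  assumes "parity_poly (degree m) m" and "degree m > 0"
    and "\<And>f g. b (f \<cdot> x) (g \<cdot> y) = top_residue m (f * g)"
  shows "isotropic_sum {f \<cdot> x + g \<cdot> y | f g. True}" "orthogonal_sum {f \<cdot> x + g \<cdot> y | f g. True}"
proof -
  note orth = graded_orthogonal[OF assms]
  show "isotropic_sum {f \<cdot> x + g \<cdot> y | f g. True}"
    unfolding isotropic_sum_def
    using swapped_sum_graded[of x y "degree m"] orth[of _ 0 "degree m" _ 0 "degree m"]
      orth[of _ 1 "Suc (degree m)" _ 1 "Suc (degree m)"]
    by (intro exI conjI ballI) auto
  show "orthogonal_sum {f \<cdot> x + g \<cdot> y | f g. True}"
    unfolding orthogonal_sum_def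
    using swapped_sum_graded[of x y "Suc (degree m)"]
      orth[of _ 0 "Suc (degree m)" _ 1 "Suc (Suc (degree m))"]
    by (intro exI conjI ballI) auto
qed

text \<open>Splitting off hyperbolic pairs, each of maximal order in what is left, produces a cyclic
  decomposition in which every invariant factor occurs twice in succession. The clause on the
  polynomials \<open>q\<close> that kill \<open>W\<close> is what keeps the divisibility chain going in the induction.\<close>
lemma symplectic_decomposition:
  assumes "submodule W" "nondegenerate_on W"
  shows "\<exists>ps zs. cyclic_basis W ps zs \<and> (\<forall>p\<in>set ps. degree p > 0 \<and> lead_coeff p = 1) \<and>
    (\<forall>i. Suc i < length ps \<longrightarrow> ps ! Suc i dvd ps ! i) \<and>
    (\<forall>q. (\<forall>w\<in>W. q \<cdot> w = 0) \<longrightarrow> (\<forall>p\<in>set ps. p dvd q)) \<and>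
    ((\<forall>p\<in>set ps. parity_poly (degree p) p) \<longrightarrow> isotropic_sum W \<and> orthogonal_sum W)"
  using assms
proof (induction "dim W" arbitrary: W rule: less_induct)
  case less
  show ?case
  proof (cases "W = {0}")
    case True
    have "swapped_sum W {0} {0}" unfolding True swapped_sum_def by (auto simp: u.zero)
    then have "isotropic_sum W" "orthogonal_sum W"
      unfolding isotropic_sum_def orthogonal_sum_def by (intro exI[of _ "{0}"]; simp)+
    then show ?thesis using cyclic_basis_Nil True by (intro exI[of _ "[]"]) auto
  next
    case False
    obtain m x y W' where x: "x \<in> W" and m: "lead_coeff m = 1" "degree m > 0"
      and kill: "\<forall>w\<in>W. m \<cdot> w = 0" and ord: "\<forall>f. f \<cdot> x = 0 \<longrightarrow> m dvd f"
      and xy: "\<forall>f g. b (f \<cdot> x) (g \<cdot> y) = top_residue m (f * g)"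
      and W': "submodule W'" "nondegenerate_on W'" and xW': "x \<notin> W'" and y: "y \<in> W"
      and xo: "\<forall>f. \<forall>w\<in>W'. b (f \<cdot> x) w = 0" and yo: "\<forall>f. \<forall>w\<in>W'. b (f \<cdot> y) w = 0"
      and W: "W = {f \<cdot> x + (g \<cdot> y + w) | f g w. w \<in> W'}"
      by (rule split_hyperbolic_pair[OF less.prems False])
    note xy = xy[rule_format]
    have "W' \<subseteq> W"
    proof
      fix w assume "w \<in> W'"
      then have "0 \<cdot> x + (0 \<cdot> y + w) \<in> W" unfolding W by blast
      then show "w \<in> W" by simp
    qed
    then have "span W' \<subset> span W"
      using x xW' submodule_subspace[OF W'(1)] submodule_subspace[OF less.prems(1)]
      by (auto simp: span_eq_iff[THEN iffD2])
    then have "dim W' < dim W" by (rule dim_psubset)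
    from less.hyps[OF this W'] obtain ps zs where basis: "cyclic_basis W' ps zs"
      and monic: "\<forall>p\<in>set ps. degree p > 0 \<and> lead_coeff p = 1"
      and chain: "\<forall>i. Suc i < length ps \<longrightarrow> ps ! Suc i dvd ps ! i"
      and dvd: "\<And>q. (\<forall>w\<in>W'. q \<cdot> w = 0) \<Longrightarrow> (\<forall>p\<in>set ps. p dvd q)"
      and sums: "(\<forall>p\<in>set ps. parity_poly (degree p) p) \<Longrightarrow> isotropic_sum W' \<and> orthogonal_sum W'"
      by metis
    have dvd_m: "\<forall>p\<in>set ps. p dvd m" using dvd kill \<open>W' \<subseteq> W\<close> by blast
    have zero: "m dvd f \<and> m dvd g \<and> w = 0" if "w \<in> W'" "f \<cdot> x + (g \<cdot> y + w) = 0" for f g w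
    proof -
      have "b (h \<cdot> x) (f \<cdot> x + (g \<cdot> y + w)) = top_residue m (g * h)" for h
        using xo that(1) by (simp add: b_add_right b_act_self xy mult.commute)
      then have g: "m dvd g" using that(2) top_residue_nondegenerate[OF m(2)] by simp
      have "b (f \<cdot> x + (g \<cdot> y + w)) (h \<cdot> y) = top_residue m (f * h)" for h
        using yo that(1) b_skew[of w "h \<cdot> y"] by (simp add: b_add_left b_act_self xy)
      then have f: "m dvd f" using that(2) top_residue_nondegenerate[OF m(2)] by simp
      have "f \<cdot> x = 0" "g \<cdot> y = 0" using f g kill x y act_dvd_zero by blast+
      then show ?thesis using f g that(2) by simp
    qed
    have dvd_zero: "f \<cdot> x = 0" "f \<cdot> y = 0" if "m dvd f" for f
      using that kill x y act_dvd_zero by blast+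
    have basis_y: "cyclic_basis {g \<cdot> y + w | g w. w \<in> W'} (m # ps) (y # zs)"
      using basis refl
    proof (rule cyclic_basis_Cons)
      show "f \<cdot> y + w = 0 \<longleftrightarrow> m dvd f \<and> w = 0" if "w \<in> W'" for f w
      proof
        assume "f \<cdot> y + w = 0"
        then show "m dvd f \<and> w = 0" using zero[OF that, of 0 f] by simp
      qed (use dvd_zero(2)[of f] in simp)
    qed
    have "cyclic_basis W (m # m # ps) (x # y # zs)"
      using basis_y
    proof (rule cyclic_basis_Cons)
      show "W = {f \<cdot> x + v | f v. v \<in> {g \<cdot> y + w | g w. w \<in> W'}}" unfolding W by blast
      show "f \<cdot> x + v = 0 \<longleftrightarrow> m dvd f \<and> v = 0" if v: "v \<in> {g \<cdot> y + w | g w. w \<in> W'}" for f v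
      proof -
        obtain g w where gw: "v = g \<cdot> y + w" "w \<in> W'" using v by blast
        show ?thesis
        proof
          assume "f \<cdot> x + v = 0"
          then have "m dvd f \<and> m dvd g \<and> w = 0" using zero[OF gw(2), of f g] gw(1) by simp
          then show "m dvd f \<and> v = 0" using dvd_zero(2)[of g] gw(1) by simp
        qed (use dvd_zero(1)[of f] in simp)
      qed
    qed
    moreover have "\<forall>p\<in>set (m # m # ps). degree p > 0 \<and> lead_coeff p = 1"
      using monic m by simp
    moreover have chain_Cons: "\<forall>i. Suc i < length (m # ps) \<longrightarrow> (m # ps) ! Suc i dvd (m # ps) ! i"
      if "\<forall>i. Suc i < length ps \<longrightarrow> ps ! Suc i dvd ps ! i" "\<forall>p\<in>set ps. p dvd m" for ps
      using that by (auto simp: nth_Cons split: nat.split)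
    then have "\<forall>i. Suc i < length (m # m # ps) \<longrightarrow> (m # m # ps) ! Suc i dvd (m # m # ps) ! i"
      using chain dvd_m by simp
    moreover have "\<forall>p\<in>set (m # m # ps). p dvd q" if "\<forall>w\<in>W. q \<cdot> w = 0" for q
    proof -
      have "\<forall>w\<in>W'. q \<cdot> w = 0" using that \<open>W' \<subseteq> W\<close> by blast
      moreover have "m dvd q" using that x ord by blast
      ultimately show ?thesis using dvd[of q] by simp
    qed
    moreover have "isotropic_sum W \<and> orthogonal_sum W"
      if par: "\<forall>p\<in>set (m # m # ps). parity_poly (degree p) p"
    proof -
      let ?H = "{f \<cdot> x + g \<cdot> y | f g. True}"
      have "W = {v + w | v w. v \<in> ?H \<and> w \<in> W'}"
        unfolding W
      proof (intro equalityI subsetI)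
        fix v assume "v \<in> {f \<cdot> x + (g \<cdot> y + w) | f g w. w \<in> W'}"
        then obtain f g w where "w \<in> W'" "v = (f \<cdot> x + g \<cdot> y) + w"
          by (auto simp: add.assoc)
        then show "v \<in> {v + w | v w. v \<in> ?H \<and> w \<in> W'}" by blast
      next
        fix v assume "v \<in> {v + w | v w. v \<in> ?H \<and> w \<in> W'}"
        then obtain f g w where "w \<in> W'" "v = f \<cdot> x + (g \<cdot> y + w)"
          by (auto simp: add.assoc)
        then show "v \<in> {f \<cdot> x + (g \<cdot> y + w) | f g w. w \<in> W'}" by blast
      qed
      moreover have "\<forall>v\<in>?H. \<forall>w\<in>W'. b v w = 0"
        using xo yo by (auto simp: b_add_left)
      moreover have "parity_poly (degree m) m" using par by simp
      ultimately show ?thesis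
        using hyperbolic_pair_sums[OF _ m(2) xy] sums par isotropic_sum_add[of ?H W']
          orthogonal_sum_add[of ?H W'] by simp
    qed
    ultimately show ?thesis by blast
  qed
qed

section \<open>Square-zero summands and the conjugator\<close>

lemma nondegenerate: "(\<And>y. b x y = 0) \<Longrightarrow> x = 0"
  using symplectic by (auto simp: symplectic_form_def nondegenerate_form_def)

text \<open>With \<open>\<pi>\<close> the projection onto \<open>M\<close> along \<open>N\<close>, the summands are \<open>u \<pi>\<close> and \<open>u (1 - \<pi>)\<close>. The first
  maps \<open>M\<close> into \<open>N\<close> and kills \<open>N\<close>, so its square is zero; it is alternating because
  \<open>b x (u (\<pi> x))\<close> differs from \<open>b (\<pi> x) (u (\<pi> x)) = 0\<close> by a value of \<open>b\<close> on \<open>N\<close>.\<close>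
lemma isotropic_sum_imp_square_zero_sum:
  assumes "isotropic_sum UNIV"
  obtains v w where "alternating_endomorphism scale b v" "alternating_endomorphism scale b w"
    "square_zero v" "square_zero w" "u = (\<lambda>x. v x + w x)"
proof -
  obtain M N where sum: "swapped_sum UNIV M N"
    and M: "\<forall>x\<in>M. \<forall>y\<in>M. b x y = 0" and N: "\<forall>x\<in>N. \<forall>y\<in>N. b x y = 0"
    using assms unfolding isotropic_sum_def by blast
  have uM: "u z \<in> N" if "z \<in> M" for z using that sum by (auto simp: swapped_sum_def)
  have uN: "u z \<in> M" if "z \<in> N" for z using that sum by (auto simp: swapped_sum_def)
  have zero: "x = 0" if "x \<in> M" "x \<in> N" for x
  proof (rule nondegenerate)
    fix z
    obtain m n where "m \<in> M" "n \<in> N" "z = m + n" using sum unfolding swapped_sum_def by blast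
    then show "b x z = 0" using M N that by (simp add: b_add_right)
  qed
  have int: "M \<inter> N \<subseteq> {0}" using zero by blast
  obtain \<pi> where lin: "endomorphism scale \<pi>" and \<pi>: "\<forall>z. \<pi> z \<in> M" "\<forall>z. z - \<pi> z \<in> N"
    "\<forall>z\<in>M. \<pi> z = z" "\<forall>z\<in>N. \<pi> z = 0" and \<pi>u: "\<forall>z. \<pi> (u z) = u (z - \<pi> z)"
    by (rule swapped_sum_projection[OF sum int])
  note \<pi> = \<pi>[rule_format] and \<pi>u = \<pi>u[rule_format]
  interpret \<pi>: Vector_Spaces.linear scale scale \<pi>
    using lin by (simp add: endomorphism_def)
  have "endomorphism scale (\<lambda>x. u (\<pi> x))" "endomorphism scale (\<lambda>x. u (x - \<pi> x))"
    unfolding endomorphism_def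
    by (unfold_locales; simp add: u.add u.scale u.diff \<pi>.add \<pi>.scale scale_right_diff_distrib)+
  moreover have "b x (u (\<pi> x)) = 0" "b x (u (x - \<pi> x)) = 0" for x
  proof -
    have x: "x = \<pi> x + (x - \<pi> x)" by simp
    have "b (x - \<pi> x) (u (\<pi> x)) = 0" "b (\<pi> x) (u (x - \<pi> x)) = 0"
      using M N \<pi> uM uN by auto
    then show "b x (u (\<pi> x)) = 0" "b x (u (x - \<pi> x)) = 0"
      using alternating_u by (subst x, simp only: b_add_left, simp)+
  qed
  ultimately have "alternating_endomorphism scale b (\<lambda>x. u (\<pi> x))"
    "alternating_endomorphism scale b (\<lambda>x. u (x - \<pi> x))"
    by (auto simp: alternating_endomorphism_def)
  moreover have "square_zero (\<lambda>x. u (\<pi> x))" "square_zero (\<lambda>x. u (x - \<pi> x))"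
    unfolding square_zero_def using \<pi> uM uN by (simp_all add: u.zero)
  moreover have "u = (\<lambda>x. u (\<pi> x) + u (x - \<pi> x))" by (simp add: u.diff)
  ultimately show thesis by (rule that)
qed

text \<open>The involution that is \<open>1\<close> on \<open>M\<close> and \<open>-1\<close> on \<open>N\<close> preserves the form because \<open>M\<close> and \<open>N\<close> are
  orthogonal, and it anticommutes with \<open>u\<close> because \<open>u\<close> exchanges them.\<close>
lemma orthogonal_sum_imp_symplectic_conjugate:
  assumes "orthogonal_sum UNIV"
  obtains g where "g \<in> symplectic_group scale b" "conjugated_by g u (\<lambda>x. - u x)"
proof -
  obtain M N where sum: "swapped_sum UNIV M N" and MN: "\<forall>x\<in>M. \<forall>y\<in>N. b x y = 0"
    using assms unfolding orthogonal_sum_def by blast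
  have NM: "b y x = 0" if "x \<in> M" "y \<in> N" for x y
    using MN that b_skew[of y x] by simp
  have zero: "x = 0" if "x \<in> M" "x \<in> N" for x
  proof (rule nondegenerate)
    fix z
    obtain m n where "m \<in> M" "n \<in> N" "z = m + n" using sum unfolding swapped_sum_def by blast
    then show "b x z = 0" using MN NM that by (simp add: b_add_right)
  qed
  have int: "M \<inter> N \<subseteq> {0}" using zero by blast
  obtain \<pi> where lin: "endomorphism scale \<pi>" and \<pi>: "\<forall>z. \<pi> z \<in> M" "\<forall>z. z - \<pi> z \<in> N"
    "\<forall>z\<in>M. \<pi> z = z" "\<forall>z\<in>N. \<pi> z = 0" and \<pi>u: "\<forall>z. \<pi> (u z) = u (z - \<pi> z)"
    by (rule swapped_sum_projection[OF sum int])
  note \<pi> = \<pi>[rule_format] and \<pi>u = \<pi>u[rule_format]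
  interpret \<pi>: Vector_Spaces.linear scale scale \<pi>
    using lin by (simp add: endomorphism_def)
  define g where "g z = \<pi> z - (z - \<pi> z)" for z
  have gg: "g (g z) = z" for z
    using \<pi>(3)[OF \<pi>(1)] by (simp add: g_def \<pi>.diff)
  have "bij g" using gg by (rule involuntory_imp_bij)
  moreover have "endomorphism scale g"
    unfolding endomorphism_def
    by unfold_locales (simp_all add: g_def \<pi>.add \<pi>.scale scale_right_diff_distrib)
  moreover have "b (g y) (g z) = b y z" for y z
  proof -
    have "b (\<pi> y) (z - \<pi> z) = 0" "b (y - \<pi> y) (\<pi> z) = 0" using MN NM \<pi> by blast+
    moreover have "b y z = b (\<pi> y + (y - \<pi> y)) (\<pi> z + (z - \<pi> z))" by simp
    ultimately show ?thesis
      unfolding g_def by (simp only: b_add_left b_add_right b_diff_left[of "\<pi> y" "y - \<pi> y"]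
        b_diff_right[of _ "\<pi> z" "z - \<pi> z"]) simp
  qed
  ultimately have "g \<in> symplectic_group scale b"
    by (simp add: symplectic_group_def automorphism_def)
  moreover have "conjugated_by g u (\<lambda>x. - u x)"
  proof -
    have "inv g = g" using gg by (simp add: inv_equality)
    moreover have "g (u z) = - u (g z)" for z
      by (simp add: g_def \<pi>u u.diff)
    ultimately show ?thesis by (auto simp: conjugated_by_def gg)
  qed
  ultimately show thesis by (rule that)
qed

end

context linear_operator
begin

section \<open>Necessity of parity\<close>

lemma invariant_factors_even_or_odd:
  assumes "\<And>ps zs k. cyclic_basis UNIV ps zs \<Longrightarrow> (\<forall>p\<in>set ps. p \<noteq> 0) \<Longrightarrow>
      (\<forall>i. Suc i < length ps \<longrightarrow> ps ! Suc i dvd ps ! i) \<Longrightarrow> k < length ps \<Longrightarrow>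
      parity_poly (degree (ps ! k)) (ps ! k)"
    and "invariant_factor scale u p"
  shows "even_poly p \<or> odd_poly p"
proof -
  obtain ps where ps: "\<forall>p\<in>set ps. degree p > 0 \<and> lead_coeff p = 1"
    "\<forall>i. Suc i < length ps \<longrightarrow> ps ! Suc i dvd ps ! i"
    "isomorphic_to_cyclic_sum scale u ps" "p \<in> set ps"
    using assms(2) by (auto simp: invariant_factor_def invariant_factor_list_def)
  obtain zs where "cyclic_basis UNIV ps zs" using isomorphic_imp_cyclic_basis[OF ps(3)] .
  moreover have nz: "\<forall>p\<in>set ps. p \<noteq> 0" using ps(1) by auto
  moreover obtain k where "k < length ps" "p = ps ! k" using ps(4) by (metis in_set_conv_nth)
  ultimately have "parity_poly (degree p) p" using assms(1) ps(2) by blast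
  then show ?thesis using even_or_odd_poly_iff nz ps(4) by blast
qed

lemma anticommuting_imp_even_or_odd:
  assumes char: "(2::'a) \<noteq> 0"
    and c: "endomorphism scale c" "\<And>x. c (u x) = - u (c x)" "\<And>x. \<exists>y. u (u x) = c y"
    and "invariant_factor scale u p"
  shows "even_poly p \<or> odd_poly p"
proof (rule invariant_factors_even_or_odd[OF _ assms(5)])
  interpret c: Vector_Spaces.linear scale scale c using c(1) by (simp add: endomorphism_def)
  fix ps zs k
  assume *: "cyclic_basis UNIV ps zs" "\<forall>p\<in>set ps. p \<noteq> 0"
    "\<forall>i. Suc i < length ps \<longrightarrow> ps ! Suc i dvd ps ! i" "k < length ps"
  have nz: "ps ! k \<noteq> 0" using * by simp
  have "ps ! k dvd monom 1 2 * reflect_var (ps ! k)"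
    using * nz c(2,3) by (intro cyclic_basis_anticommuting[where c = c]) (auto simp: c.add c.scale)
  then show "parity_poly (degree (ps ! k)) (ps ! k)"
    by (rule parity_poly_of_dvd_reflect[OF char nz])
qed

text \<open>From \<open>u = v + w\<close> with \<open>v\<^sup>2 = w\<^sup>2 = 0\<close> one gets \<open>u v + v u = u\<^sup>2\<close>, so in characteristic 2 the
  operator \<open>v\<close> acts as a derivation. In general \<open>v - w\<close> anticommutes with \<open>u\<close>, and
  \<open>(v - w)\<^sup>2 = - u\<^sup>2\<close>, so that its image contains that of \<open>u\<^sup>2\<close>.\<close>
lemma square_zero_sum_imp_even_or_odd:
  assumes v: "endomorphism scale v" "square_zero v" and w: "endomorphism scale w" "square_zero w"
    and sum: "u = (\<lambda>x. v x + w x)" and p: "invariant_factor scale u p"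
  shows "even_poly p \<or> odd_poly p"
proof -
  interpret v: Vector_Spaces.linear scale scale v using v(1) by (simp add: endomorphism_def)
  interpret w: Vector_Spaces.linear scale scale w using w(1) by (simp add: endomorphism_def)
  have zero: "v (v x) = 0" "w (w x) = 0" for x using v w by (auto simp: square_zero_def)
  have u: "u x = v x + w x" for x using sum by simp
  show ?thesis
  proof (cases "(2::'a) = 0")
    case True
    show ?thesis
    proof (rule invariant_factors_even_or_odd[OF _ p])
      fix ps zs k
      assume *: "cyclic_basis UNIV ps zs" "\<forall>p\<in>set ps. p \<noteq> 0" "k < length ps"
      have "ps ! k dvd monom 1 2 * pderiv (ps ! k)"
      proof (rule cyclic_basis_derivation[OF *(1,3) v.add v.scale True])
        show "u (v x) + v (u x) = u (u x)" for x by (simp add: u v.add w.add zero)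
      qed
      then show "parity_poly (degree (ps ! k)) (ps ! k)"
        using True * by (intro parity_poly_of_dvd_pderiv) auto
    qed
  next
    case False
    let ?c = "\<lambda>x. v x - w x"
    have cc: "u (u x) = ?c (?c (- x))" for x
      by (simp add: u v.add w.add v.diff w.diff v.neg w.neg zero)
    show ?thesis
    proof (rule anticommuting_imp_even_or_odd[OF False _ _ _ p])
      show "endomorphism scale ?c"
        unfolding endomorphism_def
        by unfold_locales (simp_all add: v.add w.add v.scale w.scale scale_right_diff_distrib)
      show "?c (u x) = - u (?c x)" for x
        by (simp add: u v.add w.add v.diff w.diff zero)
      show "\<exists>y. u (u x) = ?c y" for x using cc by blast
    qed
  qed
qed

text \<open>A conjugator of \<open>u\<close> into \<open>- u\<close> is a bijective operator that anticommutes with \<open>u\<close>.\<close>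
lemma similar_uminus_imp_even_or_odd:
  assumes char: "(2::'a) \<noteq> 0" and sim: "similar_endomorphisms scale u (\<lambda>x. - u x)"
    and p: "invariant_factor scale u p"
  shows "even_poly p \<or> odd_poly p"
proof -
  obtain g where g: "endomorphism scale g" "bij g" and conj: "(\<lambda>x. - u x) = g \<circ> u \<circ> inv g"
    using sim by (auto simp: similar_endomorphisms_def automorphism_def conjugated_by_def)
  show ?thesis
  proof (rule anticommuting_imp_even_or_odd[OF char g(1) _ _ p])
    fix x
    have "g (u x) = (g \<circ> u \<circ> inv g) (g x)" using g(2) by (simp add: bij_is_inj)
    then show "g (u x) = - u (g x)" by (simp flip: conj)
    show "\<exists>y. u (u x) = g y" using g(2) by (metis bij_pointE)
  qed
qed

end

context alternating_operator
begin

section \<open>The equivalence\<close>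

text \<open>The decomposition provides at least one list of invariant factors, to which the hypothesis
  can be applied.\<close>
lemma even_or_odd_imp_sums:
  assumes "\<forall>p. invariant_factor scale u p \<longrightarrow> even_poly p \<or> odd_poly p"
  shows "isotropic_sum UNIV \<and> orthogonal_sum UNIV"
proof -
  have "submodule UNIV" by (simp add: submodule_def)
  moreover have "nondegenerate_on UNIV" using nondegenerate by (simp add: nondegenerate_on_def)
  ultimately obtain ps zs where basis: "cyclic_basis UNIV ps zs"
    and monic: "\<forall>p\<in>set ps. degree p > 0 \<and> lead_coeff p = 1"
    and chain: "\<forall>i. Suc i < length ps \<longrightarrow> ps ! Suc i dvd ps ! i"
    and sums: "(\<forall>p\<in>set ps. parity_poly (degree p) p) \<Longrightarrow> isotropic_sum UNIV \<and> orthogonal_sum UNIV"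
    using symplectic_decomposition[of UNIV] by blast
  have "invariant_factor_list scale u ps"
    unfolding invariant_factor_list_def
    using monic chain cyclic_basis_imp_isomorphic[OF basis] by blast
  then have "even_poly p \<or> odd_poly p" if "p \<in> set ps" for p
    using assms that by (auto simp: invariant_factor_def)
  moreover have "p \<noteq> 0" if "p \<in> set ps" for p using monic that by auto
  ultimately show ?thesis using sums even_or_odd_poly_iff by blast
qed

end

theorem theorem1p8:
  fixes scale :: "'a::field \<Rightarrow> 'v::ab_group_add \<Rightarrow> 'v"
    and Basis :: "'v set"
    and b :: "'v \<Rightarrow> 'v \<Rightarrow> 'a"
    and u :: "'v \<Rightarrow> 'v"
  assumes "finite_dimensional_vector_space scale Basis"
    and "symplectic_form scale b"
    and "alternating_endomorphism scale b u"
  defines "cond_i \<equiv> \<exists>v w. alternating_endomorphism scale b v \<and> alternating_endomorphism scale b w \<and>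
                     square_zero v \<and> square_zero w \<and> u = (\<lambda>x. v x + w x)"
    and "cond_ii \<equiv> \<exists>v w. endomorphism scale v \<and> endomorphism scale w \<and>
                     square_zero v \<and> square_zero w \<and> u = (\<lambda>x. v x + w x)"
    and "cond_iii \<equiv> \<forall>p. invariant_factor scale u p \<longrightarrow> even_poly p \<or> odd_poly p"
    and "cond_iv \<equiv> similar_endomorphisms scale u (\<lambda>x. - u x)"
    and "cond_v \<equiv> \<exists>g\<in>symplectic_group scale b. conjugated_by g u (\<lambda>x. - u x)"
  shows "(cond_i \<longleftrightarrow> cond_ii) \<and> (cond_ii \<longleftrightarrow> cond_iii) \<and>
         (CHAR('a) \<noteq> 2 \<longrightarrow> (cond_iii \<longleftrightarrow> cond_iv) \<and> (cond_iv \<longleftrightarrow> cond_v))"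
proof -
  interpret finite_dimensional_vector_space scale Basis by (rule assms(1))
  interpret alternating_operator scale Basis u b
    using assms(1,2,3)
    by (intro alternating_operator.intro linear_operator.intro linear_operator_axioms.intro
        alternating_operator_axioms.intro)
      (auto simp: alternating_endomorphism_def endomorphism_def)
  have i_ii: cond_ii if cond_i
    using that unfolding cond_i_def cond_ii_def alternating_endomorphism_def by blast
  have ii_iii: cond_iii if cond_ii
    using that square_zero_sum_imp_even_or_odd unfolding cond_ii_def cond_iii_def by blast
  have iii_i: cond_i if cond_iii
    using even_or_odd_imp_sums that isotropic_sum_imp_square_zero_sum
    unfolding cond_iii_def cond_i_def by metis
  have iii_v: cond_v if cond_iii
    using even_or_odd_imp_sums that orthogonal_sum_imp_symplectic_conjugate
    unfolding cond_iii_def cond_v_def by metis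
  have v_iv: cond_iv if cond_v
    using that unfolding cond_v_def cond_iv_def similar_endomorphisms_def symplectic_group_def by blast
  have iv_iii: cond_iii if "CHAR('a) \<noteq> 2" cond_iv
  proof -
    have "(2::'a) \<noteq> 0"
    proof
      assume "(2::'a) = 0"
      then have "CHAR('a) dvd 2" using of_nat_eq_0_iff_char_dvd[of 2, where 'a = 'a] by simp
      then have "CHAR('a) = 1 \<or> CHAR('a) = 2"
        by (metis prime_nat_iff two_is_prime_nat)
      then show False using that(1) CHAR_not_1 by auto
    qed
    then show ?thesis
      using similar_uminus_imp_even_or_odd that(2) unfolding cond_iii_def cond_iv_def by blast
  qed
  show ?thesis using i_ii ii_iii iii_i iii_v v_iv iv_iii by blast
qed

end
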